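(* Let $n\ge 2$, let $d$ be a positive integer, and let $|\Psi\rangle\in\mathcal H_1\otimes\cdots\otimes\mathcal H_n\cong(\mathbb C^d)^{\otimes n}$ be a pure genuine multipartite entangled (GME) state of $n$ parties. Then $|\Psi\rangle^{\otimes(n-1)}$, regarded as an $n$-partite state in which party $i$ holds $\mathcal H_i^{\otimes(n-1)}$ (its share of each of the $n-1$ copies), is genuine multipartite nonlocal (GMNL).
   Context: GME. A pure $n$-partite state $|\Psi\rangle$ (unit vector in $\mathcal H_1\otimes\cdots\otimes\mathcal H_n$) is genuine multipartite entangled (GME) if there is no subset $\emptyset\neq M\subsetneq[n]=\{1,\dots,n\}$, with complement $\overline M=[n]\setminus M$, such that $|\Psi\rangle=|\psi_M\rangle\otimes|\psi_{\overline M}\rangle$ for some states $|\psi_M\rangle$ of the parties in $M$ and $|\psi_{\overline M}\rangle$ of the parties in $\overline M$. Distributions. An $n$-partite conditional probability distribution $P(\alpha_1\dots\alpha_n|\chi_1\dots\chi_n)$ has, for each party $i\in[n]$, an input $\chi_i$ and an output $\alpha_i$, each ranging over a finite set. Nonsignalling. A conditional distribution for a set $M$ of parties is nonsignalling if, for every party $j\in M$, the marginal obtained by summing over the output $\alpha_j$ does not depend on the input $\chi_j$. (Equivalently, the marginal on any subset of the parties is independent of the inputs of the parties outside that subset.) GMNL distribution. $P$ is genuine multipartite nonlocal (GMNL) if it cannot be written in the form $$P(\alpha_1\dots\alpha_n|\chi_1\dots\chi_n)=\sum_{M}\sum_{\lambda}q_M(\lambda)\,P_M(\{\alpha_i\}_{i\in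 M}|\{\chi_i\}_{i\in M},\lambda)\,P_{\overline M}(\{\alpha_i\}_{i\in\overline M}|\{\chi_i\}_{i\in\overline M},\lambda),$$ where $M$ ranges over the subsets $\emptyset\neq M\subsetneq[n]$, $\overline M=[n]\setminus M$, $\lambda$ ranges over a finite set, $q_M(\lambda)\ge 0$, $\sum_{M,\lambda}q_M(\lambda)=1$, and for every $M$ and $\lambda$ both $P_M(\cdot|\cdot,\lambda)$ and $P_{\overline M}(\cdot|\cdot,\lambda)$ are nonsignalling conditional probability distributions. GMNL state. A state $\rho$ on $\mathcal K_1\otimes\cdots\otimes\mathcal K_n$, with party $i$ holding $\mathcal K_i$ (for a pure state $|\Phi\rangle$, $\rho=|\Phi\rangle\langle\Phi|$), is GMNL if there exist local measurements, i.e. for each party $i$ and each input $\chi_i$ in some finite set a POVM $\{E^i_{\alpha_i|\chi_i}\}_{\alpha_i}$ on $\mathcal K_i$ with finitely many outcomes (positive semidefinite operators with $\sum_{\alpha_i}E^i_{\alpha_i|\chi_i}=\mathbb 1$), such that the distribution $P(\alpha_1\dots\alpha_n|\chi_1\dots\chi_n)=\operatorname{tr}\big(\bigotimes_{i=1}^n E^i_{\alpha_i|\chi_i}\,\rho\big)$ is GMNL. *)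

theory Defs
  imports Complex_Main "HOL-Library.FuncSet"
begin

text \<open>
  Finite-dimensional Hilbert spaces are represented in coordinates: a finite set \<open>B\<close> labels an
  orthonormal basis, a vector is its coefficient function on \<open>B\<close> and an operator its matrix
  on \<open>B\<close>; values outside \<open>B\<close> are irrelevant. If \<open>B i\<close> labels a basis of the space of party \<open>i\<close>,
  then the product basis of the joint space of the parties in \<open>M\<close> is labelled by \<open>Pi\<^sub>E M B\<close>.
\<close>

type_synonym 'b vect = "'b \<Rightarrow> complex"
type_synonym 'b oper = "'b \<Rightarrow> 'b \<Rightarrow> complex"

definition pure_state :: "'b set \<Rightarrow> 'b vect \<Rightarrow> bool" where
  "pure_state B \<psi> \<longleftrightarrow> finite B \<and> (\<Sum>x\<in>B. (cmod (\<psi> x))\<^sup>2) = 1"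

definition proper_parts :: "'i set \<Rightarrow> 'i set set" where
  "proper_parts I = {M. M \<noteq> {} \<and> M \<subset> I}"

definition gme :: "'i set \<Rightarrow> ('i \<Rightarrow> 'b set) \<Rightarrow> ('i \<Rightarrow> 'b) vect \<Rightarrow> bool" where
  "gme I B \<Psi> \<longleftrightarrow>
     \<not> (\<exists>M\<in>proper_parts I. \<exists>\<phi> \<phi>'.
          pure_state (Pi\<^sub>E M B) \<phi> \<and> pure_state (Pi\<^sub>E (I - M) B) \<phi>' \<and>
          (\<forall>x\<in>Pi\<^sub>E I B. \<Psi> x = \<phi> (restrict x M) * \<phi>' (restrict x (I - M))))"

text \<open>
  The \<open>k\<close>-fold tensor power of \<open>\<Psi>\<close>, regrouped by parties: if \<open>B i\<close> labels the basis of party \<open>i\<close>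
  for one copy, then \<open>{1..k} \<rightarrow>\<^sub>E B i\<close> labels its basis for \<open>k\<close> copies, and \<open>z i c\<close> is the label
  of party \<open>i\<close> in copy \<open>c\<close>.
\<close>

definition copies :: "'i set \<Rightarrow> nat \<Rightarrow> ('i \<Rightarrow> 'b) vect \<Rightarrow> ('i \<Rightarrow> nat \<Rightarrow> 'b) vect" where
  "copies I k \<Psi> = (\<lambda>z. \<Prod>c\<in>{1..k}. \<Psi> (\<lambda>i\<in>I. z i c))"

definition ket_bra :: "'b vect \<Rightarrow> 'b oper" where
  "ket_bra \<Phi> = (\<lambda>x y. \<Phi> x * cnj (\<Phi> y))"

definition op_comp :: "'b set \<Rightarrow> 'b oper \<Rightarrow> 'b oper \<Rightarrow> 'b oper" where
  "op_comp B S T = (\<lambda>x z. \<Sum>y\<in>B. S x y * T y z)"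

definition op_trace :: "'b set \<Rightarrow> 'b oper \<Rightarrow> complex" where
  "op_trace B S = (\<Sum>x\<in>B. S x x)"

definition tensor_op :: "'i set \<Rightarrow> ('i \<Rightarrow> 'b oper) \<Rightarrow> ('i \<Rightarrow> 'b) oper" where
  "tensor_op I F = (\<lambda>x y. \<Prod>i\<in>I. F i (x i) (y i))"

definition pos_semidef :: "'b set \<Rightarrow> 'b oper \<Rightarrow> bool" where
  "pos_semidef B S \<longleftrightarrow>
     (\<forall>v. (\<Sum>x\<in>B. \<Sum>y\<in>B. cnj (v x) * S x y * v y) \<in> \<real> \<and>
          0 \<le> Re (\<Sum>x\<in>B. \<Sum>y\<in>B. cnj (v x) * S x y * v y))"

definition povm :: "'b set \<Rightarrow> 'a set \<Rightarrow> ('a \<Rightarrow> 'b oper) \<Rightarrow> bool" where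
  "povm B A E \<longleftrightarrow> finite A \<and> (\<forall>a\<in>A. pos_semidef B (E a)) \<and>
     (\<forall>x\<in>B. \<forall>y\<in>B. (\<Sum>a\<in>A. E a x y) = (if x = y then 1 else 0))"

text \<open>
  Party \<open>i\<close> has outputs in \<open>A i\<close> and inputs in \<open>X i\<close>; \<open>P \<alpha> \<chi>\<close> is the probability of the outputs
  \<open>\<alpha>\<close> given the inputs \<open>\<chi>\<close>.
\<close>

definition cond_dist ::
  "'i set \<Rightarrow> ('i \<Rightarrow> 'a set) \<Rightarrow> ('i \<Rightarrow> 'x set) \<Rightarrow> (('i \<Rightarrow> 'a) \<Rightarrow> ('i \<Rightarrow> 'x) \<Rightarrow> real) \<Rightarrow> bool" where
  "cond_dist M A X P \<longleftrightarrow>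
     (\<forall>\<chi>\<in>Pi\<^sub>E M X. (\<forall>\<alpha>\<in>Pi\<^sub>E M A. 0 \<le> P \<alpha> \<chi>) \<and> (\<Sum>\<alpha>\<in>Pi\<^sub>E M A. P \<alpha> \<chi>) = 1)"

definition nonsignalling ::
  "'i set \<Rightarrow> ('i \<Rightarrow> 'a set) \<Rightarrow> ('i \<Rightarrow> 'x set) \<Rightarrow> (('i \<Rightarrow> 'a) \<Rightarrow> ('i \<Rightarrow> 'x) \<Rightarrow> real) \<Rightarrow> bool" where
  "nonsignalling M A X P \<longleftrightarrow>
     (\<forall>j\<in>M. \<forall>\<chi>\<in>Pi\<^sub>E M X. \<forall>x\<in>X j. \<forall>\<alpha>\<in>Pi\<^sub>E (M - {j}) A.
        (\<Sum>a\<in>A j. P (\<alpha>(j := a)) (\<chi>(j := x))) = (\<Sum>a\<in>A j. P (\<alpha>(j := a)) \<chi>))"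

text \<open>
  In \<open>gmnl_dist\<close>, \<open>Q M l\<close> and \<open>R M l\<close> are the factors of the parties in \<open>M\<close> and of the parties
  outside \<open>M\<close> in the term with index \<open>(M, l)\<close>. The values of the hidden variable can be taken to
  be natural numbers since they range over a finite set. \<open>P\<close> is meant to be a conditional
  distribution for the parties in \<open>I\<close>.
\<close>

definition gmnl_dist ::
  "'i set \<Rightarrow> ('i \<Rightarrow> 'a set) \<Rightarrow> ('i \<Rightarrow> 'x set) \<Rightarrow> (('i \<Rightarrow> 'a) \<Rightarrow> ('i \<Rightarrow> 'x) \<Rightarrow> real) \<Rightarrow> bool" where
  "gmnl_dist I A X P \<longleftrightarrow>
     \<not> (\<exists>(L :: nat set) q Q R.
          finite L \<and>
          (\<forall>M\<in>proper_parts I. \<forall>l\<in>L. 0 \<le> q M l) \<and>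
          (\<Sum>M\<in>proper_parts I. \<Sum>l\<in>L. q M l) = 1 \<and>
          (\<forall>M\<in>proper_parts I. \<forall>l\<in>L.
             cond_dist M A X (Q M l) \<and> nonsignalling M A X (Q M l) \<and>
             cond_dist (I - M) A X (R M l) \<and> nonsignalling (I - M) A X (R M l)) \<and>
          (\<forall>\<alpha>\<in>Pi\<^sub>E I A. \<forall>\<chi>\<in>Pi\<^sub>E I X.
             P \<alpha> \<chi> = (\<Sum>M\<in>proper_parts I. \<Sum>l\<in>L.
               q M l * Q M l (restrict \<alpha> M) (restrict \<chi> M)
                     * R M l (restrict \<alpha> (I - M)) (restrict \<chi> (I - M)))))"

text \<open>
  \<open>E i x a\<close> is the effect of party \<open>i\<close> for input \<open>x\<close> and output \<open>a\<close>. The trace is a nonnegative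
  real number whenever the effects and \<open>\<rho>\<close> are positive semidefinite, so \<open>Re\<close> only
  changes the type.
\<close>

definition born ::
  "'i set \<Rightarrow> ('i \<Rightarrow> 'b set) \<Rightarrow> ('i \<Rightarrow> 'x \<Rightarrow> 'a \<Rightarrow> 'b oper) \<Rightarrow> ('i \<Rightarrow> 'b) oper
     \<Rightarrow> ('i \<Rightarrow> 'a) \<Rightarrow> ('i \<Rightarrow> 'x) \<Rightarrow> real" where
  "born I K E \<rho> \<alpha> \<chi> =
     Re (op_trace (Pi\<^sub>E I K)
           (op_comp (Pi\<^sub>E I K) (tensor_op I (\<lambda>i. E i (\<chi> i) (\<alpha> i))) \<rho>))"

definition gmnl_state :: "'i set \<Rightarrow> ('i \<Rightarrow> 'b set) \<Rightarrow> ('i \<Rightarrow> 'b) oper \<Rightarrow> bool" where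
  "gmnl_state I K \<rho> \<longleftrightarrow>
     (\<exists>(A :: 'i \<Rightarrow> nat set) (X :: 'i \<Rightarrow> nat set) E.
        (\<forall>i\<in>I. finite (A i) \<and> finite (X i) \<and> X i \<noteq> {} \<and>
               (\<forall>x\<in>X i. povm (K i) (A i) (E i x))) \<and>
        gmnl_dist I A X (born I K E \<rho>))"

end

theory Submission
  imports Defs "HOL-Analysis.Analysis"
begin

text \<open>
  If a pure state is genuine multipartite entangled, then for every bipartition some product
  vector of all parties but one on each side leaves those two parties entangled. Hence the pairs
  that can be left entangled form a connected graph; take a spanning tree and use one copy of the
  state for each of its \<open>n - 1\<close> edges. In the copy of an edge \<open>{u, v}\<close> the other parties project onto
  the product vector, while \<open>u\<close> and \<open>v\<close> climb a long ladder of measurements, chosen such that the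
  event that both succeed at the bottom has a fixed probability while the total probability
  of the events that a product of two nonsignalling distributions would then force to occur is arbitrarily
  small. Every bipartition is crossed by an edge of the tree, so in a biseparable nonsignalling
  decomposition the probability that all parties succeed in all copies is at most the sum of the
  small ladder probabilities of the edges.

  At the bottom of the ladders the parties measure all copies; at the other steps only the copy
  of the edge is measured, so that failures in other copies do not count as errors.
\<close>

section \<open>Reduction to pairs of parties\<close>

text \<open>The argument amounts to one linear inequality: for every biseparable nonsignalling
  \<open>P\<close>, the probability of all successes at the bottom is at most the sum of the
  \<open>ladder_defect\<close> values of the edges. No term of it refers to the bipartition, so
  mixtures over all bipartitions obey it too. This requires all ladders to start from the same joint
  input, which is why the bottom input acts on all copies at once; and each edge has its own copy
  because the vectors that the parties need for different edges are unrelated. The order of choices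
  matters: the bottom vectors, and with them the probability \<open>p\<close> of all successes, are
  fixed before the lengths of the ladders, so the errors can be made small compared with
  \<open>p\<close>. The obstacle in finding the edges is that proportionality is not transitive
  through the zero vector, so that changing a product vector slot by slot may lose all information
  on the way.\<close>

definition parallel :: "('y \<Rightarrow> complex) \<Rightarrow> ('y \<Rightarrow> complex) \<Rightarrow> bool" where
  "parallel f g \<longleftrightarrow> (\<forall>y z. f y * g z = f z * g y)"

lemma parallel_diff: "parallel f g \<Longrightarrow> parallel f h \<Longrightarrow> parallel f (\<lambda>y. g y - h y)"
  unfolding parallel_def by (simp add: right_diff_distrib)

text \<open>\<open>parallel\<close> asks that all 2x2 minors vanish, so the zero function is
  parallel to everything; a nonzero value in the middle restores transitivity.\<close>

lemma parallel_trans: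
  assumes "parallel f g" "parallel g h" "g y0 \<noteq> 0"
  shows "parallel f h"
  unfolding parallel_def
proof (intro allI)
  fix y z
  have f: "f y = f y0 * g y / g y0" for y
    using assms(1,3) unfolding parallel_def by (simp add: field_simps)
  have h: "h y = h y0 * g y / g y0" for y
    using assms(2,3) unfolding parallel_def by (simp add: field_simps)
  show "f y * h z = f z * h y"
    by (subst (1 2) f, subst (1 2) h) simp
qed

lemma parallel_zero: "(\<And>y. f y = 0) \<Longrightarrow> parallel f g"
  by (simp add: parallel_def)

text \<open>The slots are changed one at a time along a chain of parallel values. Where the chain
  passes through zero, additivity provides a detour.\<close>

lemma parallel_if_single_slots:
  fixes H :: "('i \<Rightarrow> 'v \<Rightarrow> complex) \<Rightarrow> 'y \<Rightarrow> complex"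
  assumes "finite M"
    and add: "\<And>i w v v' y. i \<in> M \<Longrightarrow>
        H (w(i := (\<lambda>x. v x + v' x))) y = H (w(i := v)) y + H (w(i := v')) y"
    and single: "\<And>i w v v'. i \<in> M \<Longrightarrow> parallel (H (w(i := v))) (H (w(i := v')))"
    and agree: "\<And>i. i \<notin> M \<Longrightarrow> w i = w' i"
  shows "parallel (H w) (H w')"
proof -
  have "parallel (H w) (H w')"
    if "finite S" "S \<subseteq> M" "\<And>i. i \<notin> S \<Longrightarrow> w i = w' i" for S w w'
    using that
  proof (induction S arbitrary: w w' rule: finite_induct)
    case empty
    then have "w = w'" by auto
    then show ?case by (simp add: parallel_def mult.commute)
  next
    case (insert i S)
    then have iM: "i \<in> M" and SM: "S \<subseteq> M" by auto
    show ?case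
    proof (cases "\<exists>y. H w y \<noteq> 0")
      case False
      then show ?thesis by (auto intro: parallel_zero)
    next
      case True
      then obtain y0 where y0: "H w y0 \<noteq> 0" by auto
      define u where "u = w(i := w' i)"
      have wu: "parallel (H w) (H u)"
        using single[OF iM, of w "w i" "w' i"] by (simp add: u_def)
      have uw': "parallel (H u) (H w')"
        by (rule insert.IH) (use insert.prems SM in \<open>auto simp: u_def\<close>)
      show ?thesis
      proof (cases "\<exists>y. H u y \<noteq> 0")
        case True
        then show ?thesis using parallel_trans[OF wu uw'] by auto
      next
        case False
        \<comment> \<open>With \<open>w' i\<close> in slot \<open>i\<close> the value is zero, so
          the sum \<open>s\<close> gives the same value as \<open>w i\<close>. The induction
          hypothesis applies with slot \<open>i\<close> held at \<open>s\<close> and at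
          \<open>w i\<close>, and the two targets differ by \<open>H w'\<close>.\<close>
        define s where "s = (\<lambda>x. w i x + w' i x)"
        have eq: "H (w(i := s)) = H w"
          using False add[OF iM, of w "w i" "w' i"] by (auto simp: s_def u_def)
        have 1: "parallel (H (w(i := s))) (H (w'(i := s)))"
          by (rule insert.IH) (use insert.prems SM in auto)
        have 2: "parallel (H w) (H (w'(i := w i)))"
          by (rule insert.IH) (use insert.prems SM in auto)
        have "H w' = (\<lambda>y. H (w'(i := s)) y - H (w'(i := w i)) y)"
          using add[OF iM, of w' "w i" "w' i"] by (auto simp: s_def)
        then show ?thesis
          using parallel_diff[OF 1[unfolded eq] 2] by simp
      qed
    qed
  qed
  from this[OF assms(1) subset_refl agree] show ?thesis .
qed

text \<open>The amplitude of \<Psi> on the product of the complex conjugates of the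
  \<open>w i\<close>. Leaving out the conjugation makes it linear in every slot.\<close>

definition multi_eval :: "'i set \<Rightarrow> ('i \<Rightarrow> 'b set) \<Rightarrow> ('i \<Rightarrow> 'b) vect \<Rightarrow> ('i \<Rightarrow> 'b vect) \<Rightarrow> complex" where
  "multi_eval I B \<Psi> w = (\<Sum>x\<in>Pi\<^sub>E I B. (\<Prod>i\<in>I. w i (x i)) * \<Psi> x)"

definition ket :: "'b \<Rightarrow> 'b vect" where
  "ket y = (\<lambda>x. if x = y then 1 else 0)"

section \<open>Multilinearity of amplitudes\<close>

lemma sum_ket: "finite D \<Longrightarrow> z \<in> D \<Longrightarrow> (\<Sum>y\<in>D. v y * ket y z) = v z"
  unfolding ket_def by (subst sum.cong[OF refl, of _ _ "\<lambda>y. if z = y then v y else 0"]) auto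

lemma multi_eval_cong:
  "(\<And>i x. i \<in> I \<Longrightarrow> x \<in> B i \<Longrightarrow> w i x = w' i x) \<Longrightarrow> multi_eval I B \<Psi> w = multi_eval I B \<Psi> w'"
  unfolding multi_eval_def
  by (intro sum.cong arg_cong2[where f = "(*)"] prod.cong refl) (auto simp: PiE_iff)

lemma prod_fun_upd:
  fixes w :: "'i \<Rightarrow> 'v \<Rightarrow> 'c::comm_monoid_mult"
  assumes "finite I" "i \<in> I"
  shows "(\<Prod>j\<in>I. (w(i := v)) j (x j)) = v (x i) * (\<Prod>j\<in>I - {i}. w j (x j))"
proof -
  have "(\<Prod>j\<in>I - {i}. (w(i := v)) j (x j)) = (\<Prod>j\<in>I - {i}. w j (x j))"
    by (rule prod.cong) auto
  then show ?thesis using assms by (simp add: prod.remove)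
qed

lemma multi_eval_add:
  assumes "finite I" "i \<in> I"
  shows "multi_eval I B \<Psi> (w(i := (\<lambda>x. v x + v' x)))
       = multi_eval I B \<Psi> (w(i := v)) + multi_eval I B \<Psi> (w(i := v'))"
  unfolding multi_eval_def prod_fun_upd[OF assms]
  by (simp add: sum.distrib[symmetric] distrib_right)

lemma multi_eval_expand:
  assumes "finite I" "i \<in> I" "finite (B i)"
  shows "multi_eval I B \<Psi> (w(i := v)) = (\<Sum>y\<in>B i. v y * multi_eval I B \<Psi> (w(i := ket y)))"
proof -
  have "(\<Sum>y\<in>B i. v y * multi_eval I B \<Psi> (w(i := ket y)))
      = (\<Sum>x\<in>Pi\<^sub>E I B. (\<Sum>y\<in>B i. v y * ket y (x i)) * (\<Prod>j\<in>I - {i}. w j (x j)) * \<Psi> x)"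
    unfolding multi_eval_def prod_fun_upd[OF assms(1,2)] sum_distrib_left sum_distrib_right
    by (subst sum.swap) (simp add: mult.assoc)
  also have "\<dots> = multi_eval I B \<Psi> (w(i := v))"
    unfolding multi_eval_def prod_fun_upd[OF assms(1,2)]
    by (intro sum.cong refl) (use assms in \<open>auto simp: sum_ket PiE_iff\<close>)
  finally show ?thesis by simp
qed

lemma multi_eval_ket:
  assumes "finite I" "\<And>i. i \<in> I \<Longrightarrow> finite (B i)" "x \<in> Pi\<^sub>E I B"
  shows "multi_eval I B \<Psi> (\<lambda>i. ket (x i)) = \<Psi> x"
proof -
  have "(\<Prod>i\<in>I. ket (x i) (z i)) = (if z = x then 1 else 0)" if "z \<in> Pi\<^sub>E I B" for z
  proof (cases "z = x")
    case False
    then have "\<exists>i\<in>I. z i \<noteq> x i"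
      using PiE_ext[OF that assms(3)] by blast
    then obtain i where "i \<in> I" "z i \<noteq> x i" by blast
    then show ?thesis using assms(1) False by (auto simp: ket_def intro!: prod_zero bexI[of _ i])
  qed (simp add: ket_def)
  then have "multi_eval I B \<Psi> (\<lambda>i. ket (x i)) = (\<Sum>z\<in>Pi\<^sub>E I B. if z = x then \<Psi> x else 0)"
    unfolding multi_eval_def by (intro sum.cong) auto
  also have "\<dots> = \<Psi> x" using assms by (simp add: finite_PiE)
  finally show ?thesis .
qed

text \<open>Some product vector of the other parties leaves \<open>u\<close> and \<open>v\<close> entangled.\<close>

definition linked :: "'i set \<Rightarrow> ('i \<Rightarrow> 'b set) \<Rightarrow> ('i \<Rightarrow> 'b) vect \<Rightarrow> 'i \<Rightarrow> 'i \<Rightarrow> ('i \<Rightarrow> 'b vect) \<Rightarrow> bool" where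
  "linked I B \<Psi> u v w \<longleftrightarrow> u \<in> I \<and> v \<in> I \<and> u \<noteq> v \<and>
     (\<exists>a b. \<not> parallel (\<lambda>t. multi_eval I B \<Psi> (w(u := a, v := t)))
                       (\<lambda>t. multi_eval I B \<Psi> (w(u := b, v := t))))"

lemma sum_PiE_split:
  fixes f g :: "('i \<Rightarrow> 'b) \<Rightarrow> 'c::comm_semiring_0"
  assumes "M \<subseteq> I"
  shows "(\<Sum>x\<in>Pi\<^sub>E I B. f (restrict x M) * g (restrict x (I - M)))
       = (\<Sum>x\<in>Pi\<^sub>E M B. f x) * (\<Sum>x\<in>Pi\<^sub>E (I - M) B. g x)"
proof -
  have "(\<Sum>x\<in>Pi\<^sub>E I B. f (restrict x M) * g (restrict x (I - M)))
      = (\<Sum>(x, y)\<in>Pi\<^sub>E M B \<times> Pi\<^sub>E (I - M) B. f x * g y)"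
    by (rule sum.reindex_bij_witness
        [where j = "\<lambda>x. (restrict x M, restrict x (I - M))"
           and i = "\<lambda>(x, y) i. if i \<in> M then x i else y i"])
      (use assms in \<open>auto simp: PiE_iff restrict_def extensional_def fun_eq_iff\<close>)
  then show ?thesis by (simp add: sum_product sum.cartesian_product)
qed

text \<open>Arrange the amplitudes in a matrix whose rows are the product vectors of
  \<open>M\<close> and whose columns are those of the other parties. If no link crosses the cut, the
  minors in which one row slot and one column slot vary are zero.
  \<open>parallel_if_single_slots\<close>, applied once to the columns and once to the rows, extends
  this to all minors, so the matrix has rank at most one and \<Psi> is a product.\<close>

lemma cut_crossed_by_link:
  assumes "finite I" "\<And>i. i \<in> I \<Longrightarrow> finite (B i)"
    and state: "pure_state (Pi\<^sub>E I B) \<Psi>" and gme: "gme I B \<Psi>" and M: "M \<in> proper_parts I"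
  shows "\<exists>u\<in>M. \<exists>v\<in>I - M. \<exists>w. linked I B \<Psi> u v w"
proof (rule ccontr)
  assume no_link: "\<not> ?thesis"
  have MI: "M \<subseteq> I" using M by (auto simp: proper_parts_def)
  define F where "F = multi_eval I B \<Psi>"
  define mrg where "mrg = (\<lambda>w w' :: 'a \<Rightarrow> 'b vect. \<lambda>i. if i \<in> M then w i else w' i)"
  have pair: "parallel (\<lambda>t. F (w(u := a, v := t))) (\<lambda>t. F (w(u := b, v := t)))"
    if "u \<in> M" "v \<in> I - M" for u v w a b
    using that no_link MI unfolding linked_def F_def by blast
  have mrg1: "mrg (w(i := z)) w' = (mrg w w')(i := z)" if "i \<in> M" for i w w' z
    using that by (auto simp: mrg_def fun_eq_iff)
  have mrg2: "mrg w (w'(i := z)) = (mrg w w')(i := z)" if "i \<in> I - M" for i w w' z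
    using that by (auto simp: mrg_def fun_eq_iff)
  have single: "parallel (\<lambda>w'. F (mrg (w(u := a)) w')) (\<lambda>w'. F (mrg (w(u := b)) w'))"
    if u: "u \<in> M" for u w a b
  proof -
    have "F (mrg (w(u := a)) y) * F (mrg (w(u := b)) z) = F (mrg (w(u := a)) z) * F (mrg (w(u := b)) y)" for y z
    proof -
      \<comment> \<open>The amplitude sees only the slots in \<open>I - M\<close> of the column
        family; the others are copied from \<open>y\<close> so that the two families agree outside
        \<open>I - M\<close>.\<close>
      define z' where "z' = (\<lambda>i. if i \<in> I - M then z i else y i)"
      have Fz: "F (mrg x z') = F (mrg x z)" for x
        unfolding F_def by (rule multi_eval_cong) (auto simp: mrg_def z'_def)
      have "parallel (\<lambda>t. F (mrg (w(u := t)) y)) (\<lambda>t. F (mrg (w(u := t)) z'))"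
      proof (rule parallel_if_single_slots[where M = "I - M" and H = "\<lambda>w' t. F (mrg (w(u := t)) w')"])
        show "F (mrg (w(u := t)) (w'(i := \<lambda>x. v x + v' x)))
           = F (mrg (w(u := t)) (w'(i := v))) + F (mrg (w(u := t)) (w'(i := v')))"
          if "i \<in> I - M" for i w' v v' t
          unfolding mrg2[OF that] F_def using that assms(1) by (simp add: multi_eval_add)
        show "parallel (\<lambda>t. F (mrg (w(u := t)) (w'(i := v)))) (\<lambda>t. F (mrg (w(u := t)) (w'(i := v'))))"
          if i: "i \<in> I - M" for i w' v v'
          using pair[OF u i, of "mrg w w'"]
          unfolding mrg2[OF i] mrg1[OF u] parallel_def by (metis mult.commute)
      qed (use assms(1) in \<open>auto simp: z'_def\<close>)
      then show ?thesis unfolding parallel_def Fz by (metis mult.commute)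
    qed
    then show ?thesis by (simp add: parallel_def)
  qed
  have all: "F (mrg w y) * F (mrg w' z) = F (mrg w z) * F (mrg w' y)" for w w' y z
  proof -
    define w'' where "w'' = (\<lambda>i. if i \<in> M then w' i else w i)"
    have eq: "mrg w'' = mrg w'" by (auto simp: mrg_def w''_def fun_eq_iff)
    have "parallel (\<lambda>y. F (mrg w y)) (\<lambda>y. F (mrg w'' y))"
    proof (rule parallel_if_single_slots[where M = M and H = "\<lambda>w y. F (mrg w y)"])
      show "F (mrg (w(i := \<lambda>x. v x + v' x)) y) = F (mrg (w(i := v)) y) + F (mrg (w(i := v')) y)"
        if "i \<in> M" for i w v v' y
        unfolding mrg1[OF that] F_def using that MI assms(1) by (simp add: multi_eval_add subset_iff)
    qed (use single MI assms(1) finite_subset in \<open>auto simp: w''_def\<close>)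
    then show ?thesis unfolding eq parallel_def by blast
  qed
  define rj where "rj = (\<lambda>x y. \<lambda>i. if i \<in> M then x i else (y i :: 'b))"
  have fin: "finite (Pi\<^sub>E I B)" using assms by (auto intro: finite_PiE)
  have Frj: "F (mrg (\<lambda>i. ket (x i)) (\<lambda>i. ket (y i))) = \<Psi> (rj x y)"
    if "x \<in> Pi\<^sub>E I B" "y \<in> Pi\<^sub>E I B" for x y
  proof -
    have "rj x y \<in> Pi\<^sub>E I B" using that by (auto simp: rj_def PiE_iff extensional_def)
    from multi_eval_ket[OF assms(1,2) this, of \<Psi>]
    show ?thesis unfolding F_def by (simp add: rj_def mrg_def if_distrib)
  qed
  obtain x0 where x0: "x0 \<in> Pi\<^sub>E I B" "\<Psi> x0 \<noteq> 0"
  proof (atomize_elim, rule ccontr)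
    assume "\<nexists>x0. x0 \<in> Pi\<^sub>E I B \<and> \<Psi> x0 \<noteq> 0"
    then have "(\<Sum>x\<in>Pi\<^sub>E I B. (cmod (\<Psi> x))\<^sup>2) = 0" by (intro sum.neutral) auto
    then show False using state by (simp add: pure_state_def)
  qed
  \<comment> \<open>A matrix of rank one is the product of the column and the row through a nonzero
    entry, divided by that entry; here the entry belongs to \<open>x0\<close>.\<close>
  define f where "f = (\<lambda>x. \<Psi> (rj x x0))"
  define g where "g = (\<lambda>x. \<Psi> (rj x0 x) / \<Psi> x0)"
  have rj0: "rj x x = x" for x by (auto simp: rj_def)
  have fg: "\<Psi> x = f (restrict x M) * g (restrict x (I - M))" if x: "x \<in> Pi\<^sub>E I B" for x
  proof -
    have "rj (restrict x M) x0 = rj x x0" by (auto simp: rj_def fun_eq_iff)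
    moreover have "rj x0 (restrict x (I - M)) = rj x0 x"
      using x x0 by (auto simp: rj_def fun_eq_iff PiE_iff extensional_def)
    moreover have "\<Psi> x * \<Psi> x0 = \<Psi> (rj x x0) * \<Psi> (rj x0 x)"
      using all[of "\<lambda>i. ket (x i)" "\<lambda>i. ket (x i)" "\<lambda>i. ket (x0 i)" "\<lambda>i. ket (x0 i)"] x x0(1)
      by (simp add: Frj rj0)
    ultimately show ?thesis using x0 by (simp add: f_def g_def field_simps)
  qed
  define nf where "nf = (\<Sum>x\<in>Pi\<^sub>E M B. (cmod (f x))\<^sup>2)"
  define ng where "ng = (\<Sum>x\<in>Pi\<^sub>E (I - M) B. (cmod (g x))\<^sup>2)"
  have "1 = (\<Sum>x\<in>Pi\<^sub>E I B. (cmod (f (restrict x M)))\<^sup>2 * (cmod (g (restrict x (I - M))))\<^sup>2)"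
    using state fg by (simp add: pure_state_def norm_mult power_mult_distrib)
  also have "\<dots> = nf * ng"
    unfolding nf_def ng_def by (rule sum_PiE_split[OF MI])
  finally have nfg: "nf * ng = 1" by simp
  have nf0: "nf > 0" using nfg sum_nonneg[of "Pi\<^sub>E M B" "\<lambda>x. (cmod (f x))\<^sup>2"]
    by (cases "nf = 0") (auto simp: nf_def less_le)
  \<comment> \<open>Only the product \<open>nf * ng\<close> is known to be 1, so both factors are
    normalized by moving \<open>sqrt nf\<close> from \<open>f\<close> to \<open>g\<close>.\<close>
  define \<phi> where "\<phi> = (\<lambda>x. f x / complex_of_real (sqrt nf))"
  define \<phi>' where "\<phi>' = (\<lambda>x. g x * complex_of_real (sqrt nf))"
  have "finite (Pi\<^sub>E M B)" "finite (Pi\<^sub>E (I - M) B)"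
    using assms MI by (auto intro!: finite_PiE intro: finite_subset)
  then have "pure_state (Pi\<^sub>E M B) \<phi>" "pure_state (Pi\<^sub>E (I - M) B) \<phi>'"
    using nf0 nfg unfolding pure_state_def \<phi>_def \<phi>'_def
    by (auto simp: norm_divide norm_mult power_divide power_mult_distrib
        sum_divide_distrib[symmetric] sum_distrib_right[symmetric] nf_def[symmetric] ng_def[symmetric] mult.commute[of ng])
  moreover have "\<Psi> x = \<phi> (restrict x M) * \<phi>' (restrict x (I - M))" if "x \<in> Pi\<^sub>E I B" for x
    using fg[OF that] nf0 by (simp add: \<phi>_def \<phi>'_def)
  ultimately show False using gme M unfolding gme_def by blast
qed

text \<open>The tree grows as in Prim's algorithm: the cut hypothesis is applied to the set
  \<open>S\<close> reached so far. The invariant is that every set splitting \<open>S\<close> is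
  crossed by a chosen edge. A set that splits \<open>insert v' S\<close> but not \<open>S\<close>
  separates \<open>v'\<close> from all of \<open>S\<close>, hence is crossed by the new
  edge.\<close>

lemma spanning_links:
  fixes E :: "'i \<Rightarrow> 'i \<Rightarrow> 'w \<Rightarrow> bool"
  assumes "finite I" "I \<noteq> {}"
    and cut: "\<And>M. M \<in> proper_parts I \<Longrightarrow> \<exists>u\<in>M. \<exists>v\<in>I - M. \<exists>w. E u v w"
  shows "\<exists>u v w. (\<forall>c\<in>{1..card I - 1}. E (u c) (v c) (w c)) \<and>
     (\<forall>M\<in>proper_parts I. \<exists>c\<in>{1..card I - 1}. (u c \<in> M) \<noteq> (v c \<in> M))"
proof -
  have "\<exists>S u v w. S \<subseteq> I \<and> card S = Suc k \<and> (\<forall>c\<in>{1..k}. E (u c) (v c) (w c)) \<and>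
     (\<forall>M. S \<inter> M \<noteq> {} \<longrightarrow> \<not> S \<subseteq> M \<longrightarrow> (\<exists>c\<in>{1..k}. (u c \<in> M) \<noteq> (v c \<in> M)))"
    if "k < card I" for k
    using that
  proof (induction k)
    case 0
    obtain i where "i \<in> I" using assms by auto
    then show ?case by (intro exI[of _ "{i}"]) auto
  next
    case (Suc k)
    then obtain S u v w where S: "S \<subseteq> I" "card S = Suc k" "\<forall>c\<in>{1..k}. E (u c) (v c) (w c)"
      and cross: "\<And>M. S \<inter> M \<noteq> {} \<Longrightarrow> \<not> S \<subseteq> M \<Longrightarrow> \<exists>c\<in>{1..k}. (u c \<in> M) \<noteq> (v c \<in> M)"
      by (metis Suc_lessD)
    have "S \<in> proper_parts I" using S Suc.prems by (auto simp: proper_parts_def)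
    then obtain u' v' w' where new: "u' \<in> S" "v' \<in> I - S" "E u' v' w'" using cut by blast
    define uu where "uu = u(Suc k := u')"
    define vv where "vv = v(Suc k := v')"
    have "\<exists>c\<in>{1..Suc k}. (uu c \<in> M) \<noteq> (vv c \<in> M)"
      if M: "insert v' S \<inter> M \<noteq> {}" "\<not> insert v' S \<subseteq> M" for M
    proof (cases "S \<inter> M \<noteq> {} \<and> \<not> S \<subseteq> M")
      case True
      then obtain c where "c \<in> {1..k}" "(u c \<in> M) \<noteq> (v c \<in> M)" using cross by blast
      then show ?thesis by (intro bexI[of _ c]) (auto simp: uu_def vv_def)
    next
      case False
      then show ?thesis using M new by (intro bexI[of _ "Suc k"]) (auto simp: uu_def vv_def)
    qed
    moreover have "\<forall>c\<in>{1..Suc k}. E (uu c) (vv c) ((w(Suc k := w')) c)"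
      using S new by (auto simp: uu_def vv_def)
    moreover have "card (insert v' S) = Suc (Suc k)"
      using S new finite_subset[OF S(1) assms(1)] by simp
    moreover have "insert v' S \<subseteq> I" using S new by auto
    ultimately show ?case
      by (intro exI[of _ "insert v' S"] exI[of _ uu] exI[of _ vv] exI[of _ "w(Suc k := w')"] conjI allI impI)
  qed
  note grow = this
  have "card I - 1 < card I" using assms by (simp add: card_gt_0_iff)
  from grow[OF this] obtain S u v w where S: "S \<subseteq> I" "card S = Suc (card I - 1)"
    "\<forall>c\<in>{1..card I - 1}. E (u c) (v c) (w c)"
    "\<forall>M. S \<inter> M \<noteq> {} \<longrightarrow> \<not> S \<subseteq> M \<longrightarrow> (\<exists>c\<in>{1..card I - 1}. (u c \<in> M) \<noteq> (v c \<in> M))"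
    by (elim exE conjE) (rule that)
  have "card S = card I" using S(2) assms using card_gt_0_iff[of I] by simp
  then have "S = I" using S(1) by (intro card_subset_eq[OF assms(1)])
  show ?thesis
  proof (intro exI conjI ballI)
    fix M assume "M \<in> proper_parts I"
    then have "S \<inter> M \<noteq> {}" "\<not> S \<subseteq> M" unfolding \<open>S = I\<close> by (auto simp: proper_parts_def)
    then show "\<exists>c\<in>{1..card I - 1}. (u c \<in> M) \<noteq> (v c \<in> M)" using S(4) by simp
  next
    fix c assume "c \<in> {1..card I - 1}"
    then show "E (u c) (v c) (w c)" using S(3) by simp
  qed
qed

section \<open>An inequality for biseparable nonsignalling distributions\<close>

text \<open>\<open>f s\<close> and \<open>f' s\<close> stand for success and failure of one side at
  step \<open>s\<close>, \<open>g s\<close> and \<open>g' s\<close> for those of the other side;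
  nonsignalling makes the sums constant. Each drop from \<open>f s\<close> to
  \<open>f (Suc s)\<close>, weighted by \<open>G\<close>, is paid for by events in which exactly one
  side succeeds, and the drops telescope.\<close>

lemma chain_inequality:
  fixes f f' g g' :: "nat \<Rightarrow> real"
  assumes nonneg: "\<And>s. f s \<ge> 0" "\<And>s. f' s \<ge> 0" "\<And>s. g s \<ge> 0" "\<And>s. g' s \<ge> 0"
    and f: "\<And>s. f s + f' s = F" and g: "\<And>s. g s + g' s = G"
  shows "f 0 * g 0 \<le> (\<Sum>s<N. f s * g' (Suc s) + f' (Suc s) * g (Suc s)) + f N * g 0"
proof -
  have step: "(f s - f (Suc s)) * G \<le> f s * g' (Suc s) + f' (Suc s) * g (Suc s)" for s
  proof -
    have F: "F = f s + f' s" "f' (Suc s) = f s + f' s - f (Suc s)" and G: "G = g (Suc s) + g' (Suc s)"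
      using f[of s] f[of "Suc s"] g[of "Suc s"] by auto
    have "f s * g' (Suc s) + f' (Suc s) * g (Suc s) - (f s - f (Suc s)) * G
        = f' s * g (Suc s) + f (Suc s) * g' (Suc s)"
      unfolding F G by (simp add: algebra_simps)
    moreover have "f' s * g (Suc s) + f (Suc s) * g' (Suc s) \<ge> 0" using nonneg by simp
    ultimately show ?thesis by linarith
  qed
  have "(f 0 - f N) * G = (\<Sum>s<N. (f s - f (Suc s)) * G)"
    by (simp add: sum_distrib_right[symmetric] sum_lessThan_telescope')
  also have "\<dots> \<le> (\<Sum>s<N. f s * g' (Suc s) + f' (Suc s) * g (Suc s))"
    by (rule sum_mono) (rule step)
  finally have sum: "(f 0 - f N) * G \<le> (\<Sum>s<N. f s * g' (Suc s) + f' (Suc s) * g (Suc s))" .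
  have sum0: "0 \<le> (\<Sum>s<N. f s * g' (Suc s) + f' (Suc s) * g (Suc s))"
    using nonneg by (intro sum_nonneg) simp
  have "(f 0 - f N) * g 0 \<le> (\<Sum>s<N. f s * g' (Suc s) + f' (Suc s) * g (Suc s))"
  proof (cases "f 0 \<ge> f N")
    case True
    have "g 0 \<le> G" using g[of 0] nonneg(4)[of 0] by linarith
    then have "(f 0 - f N) * g 0 \<le> (f 0 - f N) * G" using True by (intro mult_left_mono) auto
    then show ?thesis using sum by linarith
  next
    case False
    then have "(f 0 - f N) * g 0 \<le> 0" using nonneg(3)[of 0] by (simp add: mult_nonpos_nonneg)
    then show ?thesis using sum0 by linarith
  qed
  then show ?thesis by (simp add: algebra_simps)
qed

text \<open>Outputs are bits, 1 meaning success; the parties outside the ladder keep the input \<open>x0\<close>.\<close>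

definition ladder_defect ::
  "'i set \<Rightarrow> 'x \<Rightarrow> (('i \<Rightarrow> nat) \<Rightarrow> ('i \<Rightarrow> 'x) \<Rightarrow> real) \<Rightarrow> 'i \<Rightarrow> 'i \<Rightarrow> nat \<Rightarrow> (nat \<Rightarrow> 'x) \<Rightarrow> real" where
  "ladder_defect I x0 P u v N h =
     (let out = (\<lambda>i\<in>I. 1); inp = (\<lambda>i\<in>I. x0) in
       (\<Sum>s<N. P (out(v := 0)) (inp(u := h s, v := h (Suc s)))
             + P (out(u := 0)) (inp(u := h (Suc s), v := h (Suc s))))
       + P out (inp(u := h N)))"

lemma restrict_fun_upd_in: "i \<in> M \<Longrightarrow> restrict (f(i := z)) M = (restrict f M)(i := z)"
  by (auto simp: restrict_def fun_eq_iff)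

lemma restrict_fun_upd_notin: "i \<notin> M \<Longrightarrow> restrict (f(i := z)) M = restrict f M"
  by (auto simp: restrict_def fun_eq_iff)

text \<open>This supplies the constants \<open>F\<close> and \<open>G\<close> of
  \<open>chain_inequality\<close>: the weight of the event that all other parties of the block
  succeed, summed over both outputs of \<open>u\<close>.\<close>

lemma nonsignalling_marginal:
  assumes ns: "nonsignalling M (\<lambda>_. {0, 1 :: nat}) X Q" and u: "u \<in> M" and x: "x \<in> X u"
    and X: "\<And>i. i \<in> M \<Longrightarrow> x0 \<in> X i"
  shows "Q (\<lambda>i\<in>M. 1) ((\<lambda>i\<in>M. x0)(u := x)) + Q ((\<lambda>i\<in>M. 1)(u := 0)) ((\<lambda>i\<in>M. x0)(u := x))
       = Q (\<lambda>i\<in>M. 1) (\<lambda>i\<in>M. x0) + Q ((\<lambda>i\<in>M. 1)(u := 0)) (\<lambda>i\<in>M. x0)"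
proof -
  have "(\<lambda>i\<in>M - {u}. 1::nat) \<in> Pi\<^sub>E (M - {u}) (\<lambda>_. {0, 1})" "(\<lambda>i\<in>M. x0) \<in> Pi\<^sub>E M X"
    using X by auto
  then have "(\<Sum>a\<in>{0, 1}. Q ((\<lambda>i\<in>M - {u}. 1)(u := a)) ((\<lambda>i\<in>M. x0)(u := x)))
      = (\<Sum>a\<in>{0, 1}. Q ((\<lambda>i\<in>M - {u}. 1)(u := a)) (\<lambda>i\<in>M. x0))"
    using ns u x unfolding nonsignalling_def by blast
  moreover have "(\<lambda>i\<in>M - {u}. 1::nat)(u := a) = (\<lambda>i\<in>M. 1)(u := a)" for a
    by (auto simp: fun_eq_iff)
  moreover have "(\<lambda>i\<in>M. 1::nat)(u := 1) = (\<lambda>i\<in>M. 1)"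
    using u by (auto simp: fun_eq_iff)
  ultimately show ?thesis by simp
qed

text \<open>If the edge crosses the cut, one factor provides \<open>f\<close> and the other
  \<open>g\<close> in \<open>chain_inequality\<close>. The first claim is for the edges inside a
  block, which must not lower the sum over all edges.\<close>

lemma ladder_defect_product:
  assumes dist: "cond_dist M (\<lambda>_. {0, 1 :: nat}) X Q" "nonsignalling M (\<lambda>_. {0, 1}) X Q"
      "cond_dist (I - M) (\<lambda>_. {0, 1}) X R" "nonsignalling (I - M) (\<lambda>_. {0, 1}) X R"
    and M: "M \<subseteq> I" and X: "\<And>i. i \<in> I \<Longrightarrow> x0 \<in> X i"
    and u: "u \<in> I" "\<And>s. h s \<in> X u" and v: "v \<in> I" "\<And>s. h s \<in> X v" and h0: "h 0 = x0"
  defines "P \<equiv> \<lambda>\<alpha> \<xi>. Q (restrict \<alpha> M) (restrict \<xi> M) * R (restrict \<alpha> (I - M)) (restrict \<xi> (I - M))"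
  shows "0 \<le> ladder_defect I x0 P u v N h"
    and "(u \<in> M) \<noteq> (v \<in> M) \<Longrightarrow> P (\<lambda>i\<in>I. 1) (\<lambda>i\<in>I. x0) \<le> ladder_defect I x0 P u v N h"
proof -
  have Q0: "0 \<le> Q \<alpha> \<xi>" if "\<alpha> \<in> M \<rightarrow>\<^sub>E {0, 1}" "\<xi> \<in> Pi\<^sub>E M X" for \<alpha> \<xi>
    using dist(1) that unfolding cond_dist_def by blast
  have R0: "0 \<le> R \<alpha> \<xi>" if "\<alpha> \<in> (I - M) \<rightarrow>\<^sub>E {0, 1}" "\<xi> \<in> Pi\<^sub>E (I - M) X" for \<alpha> \<xi>
    using dist(3) that unfolding cond_dist_def by blast
  have P0: "0 \<le> P \<alpha> \<xi>" if "\<alpha> \<in> I \<rightarrow>\<^sub>E {0, 1}" "\<xi> \<in> Pi\<^sub>E I X" for \<alpha> \<xi>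
  proof -
    have "restrict \<alpha> M \<in> M \<rightarrow>\<^sub>E {0, 1}" "restrict \<xi> M \<in> Pi\<^sub>E M X"
      "restrict \<alpha> (I - M) \<in> (I - M) \<rightarrow>\<^sub>E {0, 1}" "restrict \<xi> (I - M) \<in> Pi\<^sub>E (I - M) X"
      using that M by (auto simp: PiE_iff)
    then show ?thesis unfolding P_def using Q0 R0 by (intro mult_nonneg_nonneg) blast+
  qed
  have mem: "(\<lambda>i\<in>I. 1::nat) \<in> I \<rightarrow>\<^sub>E {0, 1}" "(\<lambda>i\<in>I. x0) \<in> Pi\<^sub>E I X" using X by auto
  have upd: "f(i := z) \<in> Pi\<^sub>E I Y" if "f \<in> Pi\<^sub>E I Y" "i \<in> I" "z \<in> Y i"
    for f i z and Y :: "'a \<Rightarrow> 'z set"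
    using that by (auto simp: PiE_iff extensional_def)
  show "0 \<le> ladder_defect I x0 P u v N h"
    unfolding ladder_defect_def Let_def
    by (intro add_nonneg_nonneg sum_nonneg P0 upd mem u v) auto
  have mem1: "(\<lambda>i\<in>J. 1::nat) \<in> J \<rightarrow>\<^sub>E {0, 1}" for J :: "'a set" by auto
  have mem2: "(\<lambda>i\<in>J. 1::nat)(i := 0) \<in> J \<rightarrow>\<^sub>E {0, 1}" if "i \<in> J" for J :: "'a set" and i
    using that by (auto simp: PiE_iff extensional_def)
  have mem3: "(\<lambda>i\<in>J. x0)(i := z) \<in> Pi\<^sub>E J X" if "J \<subseteq> I" "i \<in> J" "z \<in> X i" for J i z
    using that X by (auto simp: PiE_iff extensional_def)
  have IM: "I \<inter> M = M" "I \<inter> (I - M) = I - M" using M by auto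
  have h0M: "(\<lambda>i\<in>J. x0)(i := h 0) = (\<lambda>i\<in>J. x0)" if "i \<in> J" for J i
    using that h0 by (auto simp: fun_eq_iff)
  assume "(u \<in> M) \<noteq> (v \<in> M)"
  then consider "u \<in> M" "v \<in> I - M" | "u \<in> I - M" "v \<in> M" using u v by blast
  then show "P (\<lambda>i\<in>I. 1) (\<lambda>i\<in>I. x0) \<le> ladder_defect I x0 P u v N h"
  proof cases
    case 1
    define f where "f s = Q (\<lambda>i\<in>M. 1) ((\<lambda>i\<in>M. x0)(u := h s))" for s
    define f' where "f' s = Q ((\<lambda>i\<in>M. 1)(u := 0)) ((\<lambda>i\<in>M. x0)(u := h s))" for s
    define g where "g s = R (\<lambda>i\<in>I - M. 1) ((\<lambda>i\<in>I - M. x0)(v := h s))" for s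
    define g' where "g' s = R ((\<lambda>i\<in>I - M. 1)(v := 0)) ((\<lambda>i\<in>I - M. x0)(v := h s))" for s
    have "f 0 * g 0 \<le> (\<Sum>s<N. f s * g' (Suc s) + f' (Suc s) * g (Suc s)) + f N * g 0"
    proof (rule chain_inequality)
      show "f s + f' s = Q (\<lambda>i\<in>M. 1) (\<lambda>i\<in>M. x0) + Q ((\<lambda>i\<in>M. 1)(u := 0)) (\<lambda>i\<in>M. x0)" for s
        unfolding f_def f'_def using 1 u M X by (intro nonsignalling_marginal[OF dist(2)]) auto
      show "g s + g' s = R (\<lambda>i\<in>I - M. 1) (\<lambda>i\<in>I - M. x0) + R ((\<lambda>i\<in>I - M. 1)(v := 0)) (\<lambda>i\<in>I - M. x0)" for s
        unfolding g_def g'_def using 1 v M X by (intro nonsignalling_marginal[OF dist(4)]) auto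
      show "f s \<ge> 0" "f' s \<ge> 0" "g s \<ge> 0" "g' s \<ge> 0" for s
        unfolding f_def f'_def g_def g'_def
        by (intro Q0 R0 mem1 mem2 mem3; use 1 u(2) v(2) M in simp)+
    qed
    then show ?thesis
      unfolding ladder_defect_def Let_def P_def f_def f'_def g_def g'_def
      using 1 by (simp add: restrict_fun_upd_in restrict_fun_upd_notin IM h0M)
  next
    \<comment> \<open>The ladder is not symmetric in \<open>u\<close> and \<open>v\<close>, so the
      exchange of \<open>Q\<close> and \<open>R\<close> is a case of its own.\<close>
    case 2
    define f where "f s = R (\<lambda>i\<in>I - M. 1) ((\<lambda>i\<in>I - M. x0)(u := h s))" for s
    define f' where "f' s = R ((\<lambda>i\<in>I - M. 1)(u := 0)) ((\<lambda>i\<in>I - M. x0)(u := h s))" for s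
    define g where "g s = Q (\<lambda>i\<in>M. 1) ((\<lambda>i\<in>M. x0)(v := h s))" for s
    define g' where "g' s = Q ((\<lambda>i\<in>M. 1)(v := 0)) ((\<lambda>i\<in>M. x0)(v := h s))" for s
    have "f 0 * g 0 \<le> (\<Sum>s<N. f s * g' (Suc s) + f' (Suc s) * g (Suc s)) + f N * g 0"
    proof (rule chain_inequality)
      show "f s + f' s = R (\<lambda>i\<in>I - M. 1) (\<lambda>i\<in>I - M. x0) + R ((\<lambda>i\<in>I - M. 1)(u := 0)) (\<lambda>i\<in>I - M. x0)" for s
        unfolding f_def f'_def using 2 u M X by (intro nonsignalling_marginal[OF dist(4)]) auto
      show "g s + g' s = Q (\<lambda>i\<in>M. 1) (\<lambda>i\<in>M. x0) + Q ((\<lambda>i\<in>M. 1)(v := 0)) (\<lambda>i\<in>M. x0)" for s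
        unfolding g_def g'_def using 2 v M X by (intro nonsignalling_marginal[OF dist(2)]) auto
      show "f s \<ge> 0" "f' s \<ge> 0" "g s \<ge> 0" "g' s \<ge> 0" for s
        unfolding f_def f'_def g_def g'_def
        by (intro Q0 R0 mem1 mem2 mem3; use 2 u(2) v(2) M in simp)+
    qed
    then show ?thesis
      unfolding ladder_defect_def Let_def P_def f_def f'_def g_def g'_def
      using 2 by (simp add: restrict_fun_upd_in restrict_fun_upd_notin IM h0M mult.commute)
  qed
qed

lemma ladder_defect_sum:
  "ladder_defect I x0 (\<lambda>\<alpha> \<xi>. \<Sum>k\<in>K. q k * P k \<alpha> \<xi>) u v N h = (\<Sum>k\<in>K. q k * ladder_defect I x0 (P k) u v N h)"
  unfolding ladder_defect_def Let_def
  by (simp add: sum.distrib distrib_left sum_distrib_left sum.swap[of _ K])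

text \<open>Every term of a decomposition obeys the inequality through an edge crossing its own
  bipartition, the other edges adding nonnegative amounts. The right-hand side is the same linear
  functional for all terms, so it passes to the mixture and contradicts
  \<open>small\<close>.\<close>

lemma gmnl_dist_if_ladders_small:
  fixes X :: "'i \<Rightarrow> 'x set"
  assumes fin: "finite I" "finite C"
    and X: "\<And>i. i \<in> I \<Longrightarrow> x0 \<in> X i"
    and ends: "\<And>c. c \<in> C \<Longrightarrow> u c \<in> I \<and> v c \<in> I"
    and h: "\<And>c s. c \<in> C \<Longrightarrow> h c s \<in> X (u c) \<and> h c s \<in> X (v c) \<and> h c 0 = x0"
    and cross: "\<And>M. M \<in> proper_parts I \<Longrightarrow> \<exists>c\<in>C. (u c \<in> M) \<noteq> (v c \<in> M)"
    and small: "(\<Sum>c\<in>C. ladder_defect I x0 P (u c) (v c) (N c) (h c)) < P (\<lambda>i\<in>I. 1) (\<lambda>i\<in>I. x0)"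
  shows "gmnl_dist I (\<lambda>_. {0, 1 :: nat}) X P"
  unfolding gmnl_dist_def
proof (rule notI, elim exE conjE)
  fix L :: "nat set" and q Q R
  assume L: "finite L" and q: "\<forall>M\<in>proper_parts I. \<forall>l\<in>L. 0 \<le> q M l"
    and QR: "\<forall>M\<in>proper_parts I. \<forall>l\<in>L.
             cond_dist M (\<lambda>_. {0, 1 :: nat}) X (Q M l) \<and> nonsignalling M (\<lambda>_. {0, 1 :: nat}) X (Q M l) \<and>
             cond_dist (I - M) (\<lambda>_. {0, 1 :: nat}) X (R M l) \<and> nonsignalling (I - M) (\<lambda>_. {0, 1 :: nat}) X (R M l)"
    and P: "\<forall>\<alpha>\<in>I \<rightarrow>\<^sub>E {0, 1}. \<forall>\<xi>\<in>Pi\<^sub>E I X.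
             P \<alpha> \<xi> = (\<Sum>M\<in>proper_parts I. \<Sum>l\<in>L.
               q M l * Q M l (restrict \<alpha> M) (restrict \<xi> M)
                     * R M l (restrict \<alpha> (I - M)) (restrict \<xi> (I - M)))"
  define K where "K = proper_parts I \<times> L"
  define T where "T = (\<lambda>(M, l) \<alpha> \<xi>. Q M l (restrict \<alpha> M) (restrict \<xi> M)
                     * R M l (restrict \<alpha> (I - M)) (restrict \<xi> (I - M)))"
  define qq where "qq = (\<lambda>(M, l). q M l)"
  have PK: "P \<alpha> \<xi> = (\<Sum>k\<in>K. qq k * T k \<alpha> \<xi>)" if "\<alpha> \<in> I \<rightarrow>\<^sub>E {0, 1}" "\<xi> \<in> Pi\<^sub>E I X" for \<alpha> \<xi>
    using P that by (simp add: K_def T_def qq_def sum.cartesian_product split_def mult.assoc)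
  have mem: "(\<lambda>i\<in>I. 1::nat) \<in> I \<rightarrow>\<^sub>E {0, 1}" "(\<lambda>i\<in>I. x0) \<in> Pi\<^sub>E I X" using X by auto
  have upd: "f(i := z) \<in> Pi\<^sub>E I Y" if "f \<in> Pi\<^sub>E I Y" "i \<in> I" "z \<in> Y i"
    for f i z and Y :: "'i \<Rightarrow> 'z set"
    using that by (auto simp: PiE_iff extensional_def)
  have ld: "ladder_defect I x0 P (u c) (v c) (N c) (h c)
      = (\<Sum>k\<in>K. qq k * ladder_defect I x0 (T k) (u c) (v c) (N c) (h c))" if c: "c \<in> C" for c
  proof -
    have "ladder_defect I x0 P (u c) (v c) (N c) (h c)
       = ladder_defect I x0 (\<lambda>\<alpha> \<xi>. \<Sum>k\<in>K. qq k * T k \<alpha> \<xi>) (u c) (v c) (N c) (h c)"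
      unfolding ladder_defect_def Let_def
      by (intro arg_cong2[where f = "(+)"] sum.cong refl PK mem upd) (use ends[OF c] h[OF c] in auto)
    then show ?thesis by (simp add: ladder_defect_sum)
  qed
  have bound: "T k (\<lambda>i\<in>I. 1) (\<lambda>i\<in>I. x0) \<le> (\<Sum>c\<in>C. ladder_defect I x0 (T k) (u c) (v c) (N c) (h c))"
    if kK: "k \<in> K" for k
  proof -
    obtain M l where k: "k = (M, l)" "M \<in> proper_parts I" "l \<in> L" using kK by (auto simp: K_def)
    then have M: "M \<subseteq> I" by (auto simp: proper_parts_def)
    note ld_prod = ladder_defect_product[OF QR[rule_format, OF k(2,3), THEN conjunct1]
        QR[rule_format, OF k(2,3), THEN conjunct2, THEN conjunct1]
        QR[rule_format, OF k(2,3), THEN conjunct2, THEN conjunct2, THEN conjunct1]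
        QR[rule_format, OF k(2,3), THEN conjunct2, THEN conjunct2, THEN conjunct2] M X]
    obtain c where c: "c \<in> C" "(u c \<in> M) \<noteq> (v c \<in> M)" using cross k by blast
    have "T k (\<lambda>i\<in>I. 1) (\<lambda>i\<in>I. x0) \<le> ladder_defect I x0 (T k) (u c) (v c) (N c) (h c)"
      unfolding T_def k prod.case by (rule ld_prod(2)) (use c ends h in auto)
    also have "\<dots> \<le> (\<Sum>c\<in>C. ladder_defect I x0 (T k) (u c) (v c) (N c) (h c))"
    proof (rule member_le_sum[OF c(1) _ fin(2)])
      fix c' assume "c' \<in> C - {c}"
      then show "0 \<le> ladder_defect I x0 (T k) (u c') (v c') (N c') (h c')"
        unfolding T_def k prod.case by (intro ld_prod(1)) (use ends h in auto)
    qed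
    finally show ?thesis .
  qed
  have "P (\<lambda>i\<in>I. 1) (\<lambda>i\<in>I. x0) = (\<Sum>k\<in>K. qq k * T k (\<lambda>i\<in>I. 1) (\<lambda>i\<in>I. x0))"
    using PK mem by blast
  also have "\<dots> \<le> (\<Sum>k\<in>K. qq k * (\<Sum>c\<in>C. ladder_defect I x0 (T k) (u c) (v c) (N c) (h c)))"
    by (intro sum_mono mult_left_mono bound) (use q in \<open>auto simp: K_def qq_def\<close>)
  also have "\<dots> = (\<Sum>c\<in>C. ladder_defect I x0 P (u c) (v c) (N c) (h c))"
    by (simp add: ld sum_distrib_left sum.swap[of _ K])
  finally show False using small by linarith
qed

section \<open>Projective measurements on several copies\<close>

text \<open>The expectation value of \<open>S\<close> in the state \<Phi>, written in the form in
  which the trace against \<open>ket_bra\<close> produces it.\<close>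

definition quad :: "'b set \<Rightarrow> 'b oper \<Rightarrow> 'b vect \<Rightarrow> complex" where
  "quad B S \<Phi> = (\<Sum>x\<in>B. \<Sum>y\<in>B. S x y * (\<Phi> y * cnj (\<Phi> x)))"

definition projector :: "'b set \<Rightarrow> 'b oper \<Rightarrow> bool" where
  "projector B S \<longleftrightarrow> (\<forall>x\<in>B. \<forall>y\<in>B. cnj (S x y) = S y x) \<and>
     (\<forall>x\<in>B. \<forall>z\<in>B. (\<Sum>y\<in>B. S x y * S y z) = S x z)"

text \<open>Inclusion of ranges, the operator order on projectors. It is expressed by
  \<open>S T = S\<close> because this equation passes factor by factor to tensor products.\<close>

definition subprojector :: "'b set \<Rightarrow> 'b oper \<Rightarrow> 'b oper \<Rightarrow> bool" where
  "subprojector B S T \<longleftrightarrow> projector B S \<and> projector B T \<and>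
     (\<forall>x\<in>B. \<forall>z\<in>B. (\<Sum>y\<in>B. S x y * T y z) = S x z)"

definition ident :: "'b oper" where
  "ident = (\<lambda>x y. if x = y then 1 else 0)"

text \<open>The projector onto the complex conjugate of \<open>w\<close>, so that no conjugates occur in \<open>multi_eval\<close>.\<close>

definition rank_one :: "'b vect \<Rightarrow> 'b oper" where
  "rank_one w = (\<lambda>x y. cnj (w x) * w y)"

definition op_diff :: "'b oper \<Rightarrow> 'b oper \<Rightarrow> 'b oper" where
  "op_diff T S = (\<lambda>x y. T x y - S x y)"

lemma born_ket_bra:
  "born I K E (ket_bra \<Phi>) \<alpha> \<xi> = Re (quad (Pi\<^sub>E I K) (tensor_op I (\<lambda>i. E i (\<xi> i) (\<alpha> i))) \<Phi>)"
  by (simp add: born_def quad_def op_trace_def op_comp_def ket_bra_def)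

lemma quad_cong: "(\<And>x y. x \<in> B \<Longrightarrow> y \<in> B \<Longrightarrow> S x y = T x y) \<Longrightarrow> quad B S \<Phi> = quad B T \<Phi>"
  unfolding quad_def by (intro sum.cong refl) simp

lemma quad_op_diff: "quad B (op_diff T S) \<Phi> = quad B T \<Phi> - quad B S \<Phi>"
  by (simp add: quad_def op_diff_def left_diff_distrib sum_subtractf)

lemma quad_sum: "quad B (\<lambda>x y. \<Sum>k\<in>K. S k x y) \<Phi> = (\<Sum>k\<in>K. quad B (S k) \<Phi>)"
  by (simp add: quad_def sum_distrib_right sum.swap[of _ K])

text \<open>A projector equals its adjoint times itself, so the expectation is the squared norm of
  the image of \<Phi>.\<close>

lemma quad_projector:
  assumes "projector B S"
  shows "quad B S \<Phi> = of_real (\<Sum>z\<in>B. (cmod (\<Sum>y\<in>B. S z y * \<Phi> y))\<^sup>2)"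
proof -
  have "quad B S \<Phi> = (\<Sum>x\<in>B. \<Sum>y\<in>B. (\<Sum>z\<in>B. cnj (S z x) * S z y) * (\<Phi> y * cnj (\<Phi> x)))"
    unfolding quad_def
  proof (rule sum.cong[OF refl], rule sum.cong[OF refl])
    fix x y assume xy: "x \<in> B" "y \<in> B"
    then have "S x y = (\<Sum>z\<in>B. S x z * S z y)" using assms by (simp add: projector_def)
    also have "\<dots> = (\<Sum>z\<in>B. cnj (S z x) * S z y)"
      using assms xy by (intro sum.cong refl) (simp add: projector_def)
    finally show "S x y * (\<Phi> y * cnj (\<Phi> x)) = (\<Sum>z\<in>B. cnj (S z x) * S z y) * (\<Phi> y * cnj (\<Phi> x))"
      by simp
  qed
  also have "\<dots> = (\<Sum>z\<in>B. \<Sum>x\<in>B. \<Sum>y\<in>B. (cnj (S z x) * S z y) * (\<Phi> y * cnj (\<Phi> x)))"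
    unfolding sum_distrib_right by (subst sum.swap[of _ B B], subst (2) sum.swap) (rule refl)
  also have "\<dots> = (\<Sum>z\<in>B. (\<Sum>y\<in>B. S z y * \<Phi> y) * cnj (\<Sum>x\<in>B. S z x * \<Phi> x))"
    by (intro sum.cong refl) (simp add: sum_product mult_ac, subst sum.swap, simp add: mult_ac)
  also have "\<dots> = of_real (\<Sum>z\<in>B. (cmod (\<Sum>y\<in>B. S z y * \<Phi> y))\<^sup>2)"
    by (simp only: complex_norm_square of_real_sum)
  finally show ?thesis .
qed

lemma projector_op_diff:
  assumes "subprojector B S T"
  shows "projector B (op_diff T S)"
  unfolding projector_def
proof (intro conjI ballI)
  have S: "projector B S" and T: "projector B T"
    and ST: "\<And>x z. x \<in> B \<Longrightarrow> z \<in> B \<Longrightarrow> (\<Sum>y\<in>B. S x y * T y z) = S x z"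
    using assms by (auto simp: subprojector_def)
  fix x y assume xy: "x \<in> B" "y \<in> B"
  then show "cnj (op_diff T S x y) = op_diff T S y x"
    using S T by (simp add: op_diff_def projector_def)
  have "(\<Sum>z\<in>B. T x z * S z y) = cnj (\<Sum>z\<in>B. S y z * T z x)"
    unfolding cnj_sum by (intro sum.cong refl) (use S T xy in \<open>simp add: projector_def mult.commute\<close>)
  also have "\<dots> = S x y" using ST[of y x] S xy by (simp add: projector_def)
  finally show "(\<Sum>z\<in>B. op_diff T S x z * op_diff T S z y) = op_diff T S x y"
    using S T ST xy
    by (simp add: op_diff_def projector_def left_diff_distrib right_diff_distrib sum_subtractf)
qed

lemma quad_mono:
  assumes "subprojector B S T"
  shows "Re (quad B S \<Phi>) \<le> Re (quad B T \<Phi>)"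
proof -
  have "0 \<le> Re (quad B (op_diff T S) \<Phi>)"
    unfolding quad_projector[OF projector_op_diff[OF assms]] by (simp add: sum_nonneg)
  then show ?thesis by (simp add: quad_op_diff)
qed

lemma pos_semidef_projector:
  assumes "projector B S"
  shows "pos_semidef B S"
proof -
  have "(\<Sum>x\<in>B. \<Sum>y\<in>B. cnj (v x) * S x y * v y) = quad B S v" for v
    unfolding quad_def by (intro sum.cong refl) (simp add: mult_ac)
  then show ?thesis
    unfolding pos_semidef_def quad_projector[OF assms] by (simp add: sum_nonneg)
qed

lemma sum_ident:
  assumes "finite B" "z \<in> B"
  shows "(\<Sum>y\<in>B. f y * ident y z) = f z" "(\<Sum>y\<in>B. ident z y * f y) = f z"
proof -
  have "(\<Sum>y\<in>B. f y * ident y z) = (\<Sum>y\<in>B. if y = z then f y else 0)"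
    "(\<Sum>y\<in>B. ident z y * f y) = (\<Sum>y\<in>B. if z = y then f y else 0)"
    by (intro sum.cong; simp add: ident_def)+
  then show "(\<Sum>y\<in>B. f y * ident y z) = f z" "(\<Sum>y\<in>B. ident z y * f y) = f z"
    using assms by simp_all
qed

lemma projector_ident: "finite B \<Longrightarrow> projector B ident"
  by (simp add: projector_def sum_ident) (simp add: ident_def)

lemma subprojector_ident: "finite B \<Longrightarrow> projector B S \<Longrightarrow> subprojector B S ident"
  by (simp add: subprojector_def projector_ident sum_ident)

lemma subprojector_refl: "projector B S \<Longrightarrow> subprojector B S S"
  by (simp add: subprojector_def projector_def)

lemma projector_rank_one:
  assumes "(\<Sum>x\<in>B. (cmod (w x))\<^sup>2) = 1"
  shows "projector B (rank_one w)"
proof -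
  have "(\<Sum>y\<in>B. w y * cnj (w y)) = 1"
    using arg_cong[OF assms, of complex_of_real] by (simp add: complex_norm_square del: of_real_power)
  moreover have "(\<Sum>y\<in>B. cnj (w x) * w y * (cnj (w y) * w z)) = cnj (w x) * w z * (\<Sum>y\<in>B. w y * cnj (w y))" for x z
    by (simp add: sum_distrib_left mult_ac)
  ultimately show ?thesis by (simp add: projector_def rank_one_def mult.commute)
qed

section \<open>Tensor products of projectors over parties and over copies\<close>

lemma tensor_op_comp:
  assumes "finite I" "\<And>i. i \<in> I \<Longrightarrow> finite (K i)"
  shows "(\<Sum>y\<in>Pi\<^sub>E I K. tensor_op I F x y * tensor_op I G y z)
       = (\<Prod>i\<in>I. \<Sum>y\<in>K i. F i (x i) y * G i y (z i))"
  using assms by (subst prod_sum_PiE) (simp_all add: tensor_op_def prod.distrib)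

lemma projector_tensor_op:
  assumes "finite I" "\<And>i. i \<in> I \<Longrightarrow> finite (K i)" "\<And>i. i \<in> I \<Longrightarrow> projector (K i) (F i)"
  shows "projector (Pi\<^sub>E I K) (tensor_op I F)"
  unfolding projector_def
proof (intro conjI ballI)
  fix x z assume xz: "x \<in> Pi\<^sub>E I K" "z \<in> Pi\<^sub>E I K"
  show "cnj (tensor_op I F x z) = tensor_op I F z x"
    unfolding tensor_op_def cnj_prod
    by (intro prod.cong refl) (use assms(3) xz in \<open>auto simp: projector_def PiE_iff\<close>)
  show "(\<Sum>y\<in>Pi\<^sub>E I K. tensor_op I F x y * tensor_op I F y z) = tensor_op I F x z"
    by (subst tensor_op_comp[OF assms(1,2)], assumption, unfold tensor_op_def, intro prod.cong refl) (use assms(3) xz in \<open>auto simp: projector_def PiE_iff\<close>)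
qed

lemma subprojector_tensor_op:
  assumes "finite I" "\<And>i. i \<in> I \<Longrightarrow> finite (K i)" "\<And>i. i \<in> I \<Longrightarrow> subprojector (K i) (F i) (G i)"
  shows "subprojector (Pi\<^sub>E I K) (tensor_op I F) (tensor_op I G)"
  unfolding subprojector_def
proof (intro conjI ballI projector_tensor_op assms(1,2))
  fix x z assume xz: "x \<in> Pi\<^sub>E I K" "z \<in> Pi\<^sub>E I K"
  show "(\<Sum>y\<in>Pi\<^sub>E I K. tensor_op I F x y * tensor_op I G y z) = tensor_op I F x z"
    by (subst tensor_op_comp[OF assms(1,2)], assumption, unfold tensor_op_def, intro prod.cong refl) (use assms(3) xz in \<open>auto simp: subprojector_def PiE_iff\<close>)
qed (use assms(3) in \<open>auto simp: subprojector_def\<close>)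

lemma tensor_op_ident:
  assumes "finite I" "x \<in> Pi\<^sub>E I K" "y \<in> Pi\<^sub>E I K"
  shows "tensor_op I (\<lambda>_. ident) x y = ident x y"
proof (cases "x = y")
  case False
  then have "\<exists>i\<in>I. x i \<noteq> y i" using PiE_ext[OF assms(2,3)] by blast
  then show ?thesis using assms(1) False by (auto simp: tensor_op_def ident_def intro!: prod_zero)
qed (simp add: tensor_op_def ident_def)

lemma tensor_op_fun_upd:
  assumes "finite I" "i \<in> I"
  shows "tensor_op I (F(i := S)) x y = S (x i) (y i) * (\<Prod>j\<in>I - {i}. F j (x j) (y j))"
proof -
  have "(\<Prod>j\<in>I - {i}. (F(i := S)) j (x j) (y j)) = (\<Prod>j\<in>I - {i}. F j (x j) (y j))"
    by (rule prod.cong) auto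
  then show ?thesis using assms by (simp add: tensor_op_def prod.remove)
qed

lemma tensor_op_op_diff:
  assumes "finite I" "i \<in> I"
  shows "tensor_op I (F(i := op_diff S T)) = op_diff (tensor_op I (F(i := S))) (tensor_op I (F(i := T)))"
  by (intro ext) (simp add: op_diff_def tensor_op_fun_upd[OF assms] left_diff_distrib)

lemma quad_ident: "finite B \<Longrightarrow> quad B ident \<Phi> = of_real (\<Sum>x\<in>B. (cmod (\<Phi> x))\<^sup>2)"
  by (simp add: quad_def sum_ident complex_norm_square del: of_real_power)

text \<open>Reading labels copy by copy instead of party by party, which is the transposition
  \<open>t\<close>, turns state and operator into products over the copies; the sum of products is
  then a product of sums.\<close>

lemma quad_copies:
  assumes "finite I" "finite D"
  shows "quad (I \<rightarrow>\<^sub>E ({1..k} \<rightarrow>\<^sub>E D)) (tensor_op I (\<lambda>i. tensor_op {1..k} (S i))) (copies I k \<Psi>)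
       = (\<Prod>c\<in>{1..k}. quad (I \<rightarrow>\<^sub>E D) (tensor_op I (\<lambda>i. S i c)) \<Psi>)"
proof -
  define C where "C = {1..k}"
  define t where "t = (\<lambda>z :: nat \<Rightarrow> 'a \<Rightarrow> 'b. \<lambda>i\<in>I. \<lambda>c\<in>C. z c i)"
  define t' where "t' = (\<lambda>z :: 'a \<Rightarrow> nat \<Rightarrow> 'b. \<lambda>c\<in>C. \<lambda>i\<in>I. z i c)"
  have reindex: "(\<Sum>z\<in>I \<rightarrow>\<^sub>E (C \<rightarrow>\<^sub>E D). f z) = (\<Sum>z\<in>C \<rightarrow>\<^sub>E (I \<rightarrow>\<^sub>E D). f (t z))" for f :: "_ \<Rightarrow> complex"
  proof (rule sum.reindex_bij_witness[where i = t and j = t'])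
    fix z assume z: "z \<in> I \<rightarrow>\<^sub>E (C \<rightarrow>\<^sub>E D)"
    show "t (t' z) = z"
    proof (intro ext)
      fix i c
      show "t (t' z) i c = z i c"
        using z by (cases "i \<in> I"; cases "c \<in> C") (auto simp: t_def t'_def PiE_iff extensional_def)
    qed
    then show "f (t (t' z)) = f z" by simp
    show "t' z \<in> C \<rightarrow>\<^sub>E (I \<rightarrow>\<^sub>E D)" using z by (auto simp: t'_def PiE_iff)
  next
    fix z assume z: "z \<in> C \<rightarrow>\<^sub>E (I \<rightarrow>\<^sub>E D)"
    show "t' (t z) = z"
    proof (intro ext)
      fix c i
      show "t' (t z) c i = z c i"
        using z by (cases "i \<in> I"; cases "c \<in> C") (auto simp: t_def t'_def PiE_iff extensional_def)
    qed
    show "t z \<in> I \<rightarrow>\<^sub>E (C \<rightarrow>\<^sub>E D)" using z by (auto simp: t_def PiE_iff)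
  qed
  define g where "g = (\<lambda>c x y. tensor_op I (\<lambda>i. S i c) x y * (\<Psi> y * cnj (\<Psi> x)))"
  have copies_t: "copies I k \<Psi> (t z) = (\<Prod>c\<in>C. \<Psi> (z c))" if "z \<in> C \<rightarrow>\<^sub>E (I \<rightarrow>\<^sub>E D)" for z
    unfolding copies_def C_def[symmetric]
  proof (intro prod.cong refl arg_cong[where f = \<Psi>])
    fix c assume "c \<in> C"
    then show "(\<lambda>i\<in>I. t z i c) = z c" using that
      by (auto simp: t_def fun_eq_iff PiE_iff extensional_def)
  qed
  have tens: "tensor_op I (\<lambda>i. tensor_op C (S i)) (t x) (t y) = (\<Prod>c\<in>C. tensor_op I (\<lambda>i. S i c) (x c) (y c))"
    for x y
    unfolding tensor_op_def by (subst (2) prod.swap) (intro prod.cong refl, simp add: t_def)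
  have "quad (I \<rightarrow>\<^sub>E (C \<rightarrow>\<^sub>E D)) (tensor_op I (\<lambda>i. tensor_op C (S i))) (copies I k \<Psi>)
     = (\<Sum>x\<in>C \<rightarrow>\<^sub>E (I \<rightarrow>\<^sub>E D). \<Sum>y\<in>C \<rightarrow>\<^sub>E (I \<rightarrow>\<^sub>E D). \<Prod>c\<in>C. g c (x c) (y c))"
    unfolding quad_def reindex
    by (intro sum.cong refl) (simp add: copies_t tens g_def prod.distrib)
  also have "\<dots> = (\<Sum>x\<in>C \<rightarrow>\<^sub>E (I \<rightarrow>\<^sub>E D). \<Prod>c\<in>C. \<Sum>y\<in>I \<rightarrow>\<^sub>E D. g c (x c) y)"
    using assms by (intro sum.cong refl, subst prod_sum_PiE) (auto simp: C_def intro!: finite_PiE)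
  also have "\<dots> = (\<Prod>c\<in>C. \<Sum>x\<in>I \<rightarrow>\<^sub>E D. \<Sum>y\<in>I \<rightarrow>\<^sub>E D. g c x y)"
    using assms by (subst prod_sum_PiE) (auto simp: C_def intro!: finite_PiE)
  finally show ?thesis unfolding C_def g_def quad_def .
qed

lemma quad_copies_single:
  assumes "finite I" "finite D" "c \<in> {1..k}" "pure_state (I \<rightarrow>\<^sub>E D) \<Psi>"
  shows "quad (I \<rightarrow>\<^sub>E ({1..k} \<rightarrow>\<^sub>E D)) (tensor_op I (\<lambda>i. tensor_op {1..k} ((\<lambda>_. ident)(c := S i)))) (copies I k \<Psi>)
       = quad (I \<rightarrow>\<^sub>E D) (tensor_op I S) \<Psi>"
proof -
  have "quad (I \<rightarrow>\<^sub>E D) (tensor_op I (\<lambda>i. ((\<lambda>_. ident)(c := S i)) c')) \<Psi> = 1"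
    if "c' \<in> {1..k} - {c}" for c'
  proof -
    have "quad (I \<rightarrow>\<^sub>E D) (tensor_op I (\<lambda>i. ((\<lambda>_. ident)(c := S i)) c')) \<Psi> = quad (I \<rightarrow>\<^sub>E D) ident \<Psi>"
      using that assms(1) by (intro quad_cong) (simp add: tensor_op_ident)
    then show ?thesis using assms by (simp add: quad_ident finite_PiE pure_state_def del: of_real_sum of_real_power)
  qed
  then show ?thesis
    unfolding quad_copies[OF assms(1,2)] using assms(3) by (subst prod.remove[of _ c]) auto
qed

lemma quad_rank_one:
  "quad (Pi\<^sub>E I B) (tensor_op I (\<lambda>i. rank_one (w i))) \<Psi> = of_real ((cmod (multi_eval I B \<Psi> w))\<^sup>2)"
  unfolding complex_norm_square multi_eval_def quad_def cnj_sum sum_product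
  by (subst sum.swap) (simp add: tensor_op_def rank_one_def prod.distrib mult_ac)

lemma ident_eq_sum_rank_one:
  assumes "finite D" "x \<in> D"
  shows "ident x y = (\<Sum>z\<in>D. rank_one (ket z) x y)"
proof -
  have "rank_one (ket z) x y = (if x = z then ident x y else 0)" for z
    by (auto simp: rank_one_def ket_def ident_def)
  then show ?thesis using assms by simp
qed

text \<open>The probability that \<open>i\<close> fails while the others succeed. The total with
  \<open>i\<close> unmeasured is expanded over basis kets, so that only squared amplitudes
  remain.\<close>

lemma quad_complement:
  assumes "finite I" "i \<in> I" "finite (B i)"
  shows "quad (Pi\<^sub>E I B) (tensor_op I ((\<lambda>j. rank_one (w j))(i := op_diff ident (rank_one b)))) \<Psi>
     = of_real ((\<Sum>z\<in>B i. (cmod (multi_eval I B \<Psi> (w(i := ket z))))\<^sup>2) - (cmod (multi_eval I B \<Psi> (w(i := b))))\<^sup>2)"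
proof -
  have one: "quad (Pi\<^sub>E I B) (tensor_op I ((\<lambda>j. rank_one (w j))(i := rank_one b))) \<Psi>
      = of_real ((cmod (multi_eval I B \<Psi> (w(i := b))))\<^sup>2)" for b
  proof -
    have "(\<lambda>j. rank_one (w j))(i := rank_one b) = (\<lambda>j. rank_one ((w(i := b)) j))" by auto
    then show ?thesis by (simp only: quad_rank_one)
  qed
  have "quad (Pi\<^sub>E I B) (tensor_op I ((\<lambda>j. rank_one (w j))(i := ident))) \<Psi>
      = quad (Pi\<^sub>E I B) (\<lambda>x y. \<Sum>z\<in>B i. tensor_op I ((\<lambda>j. rank_one (w j))(i := rank_one (ket z))) x y) \<Psi>"
    by (intro quad_cong, unfold tensor_op_fun_upd[OF assms(1,2)])
      (use assms in \<open>auto simp: ident_eq_sum_rank_one sum_distrib_right PiE_iff\<close>)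
  then show ?thesis
    unfolding tensor_op_op_diff[OF assms(1,2)] quad_op_diff
    by (simp add: quad_sum one)
qed

section \<open>Ladders of measurements on an entangled pair\<close>

definition norm2 :: "'b set \<Rightarrow> 'b vect \<Rightarrow> real" where
  "norm2 X a = (\<Sum>x\<in>X. (cmod (a x))\<^sup>2)"

definition ip :: "'b set \<Rightarrow> 'b vect \<Rightarrow> 'b vect \<Rightarrow> complex" where
  "ip X a c = (\<Sum>x\<in>X. a x * cnj (c x))"

text \<open>\<open>T\<close> holds the coefficients of the unnormalized state of a pair. If the
  first party projects onto the conjugate of \<open>a\<close>, this is what the second party is left
  with.\<close>

definition contract :: "'a set \<Rightarrow> ('a \<Rightarrow> 'b \<Rightarrow> complex) \<Rightarrow> 'a vect \<Rightarrow> 'b vect" where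
  "contract X T a = (\<lambda>y. \<Sum>x\<in>X. a x * T x y)"

definition bil :: "'a set \<Rightarrow> 'b set \<Rightarrow> ('a \<Rightarrow> 'b \<Rightarrow> complex) \<Rightarrow> 'a vect \<Rightarrow> 'b vect \<Rightarrow> complex" where
  "bil X Y T a b = (\<Sum>x\<in>X. \<Sum>y\<in>Y. a x * b y * T x y)"

lemma bil_contract: "bil X Y T a b = (\<Sum>y\<in>Y. contract X T a y * b y)"
  unfolding bil_def contract_def sum_distrib_right by (subst sum.swap) (simp add: mult_ac)

lemma norm2_nonneg: "norm2 X a \<ge> 0"
  by (simp add: norm2_def sum_nonneg)

lemma ip_self: "ip X a a = of_real (norm2 X a)"
  by (simp only: ip_def norm2_def of_real_sum complex_norm_square)

lemma cnj_ip: "cnj (ip X a c) = ip X c a"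
  by (simp add: ip_def mult.commute)

lemma ip_add_left: "ip X (\<lambda>x. a x + b x) c = ip X a c + ip X b c"
  by (simp add: ip_def sum.distrib distrib_right)

lemma ip_add_right: "ip X c (\<lambda>x. a x + b x) = ip X c a + ip X c b"
  by (simp add: ip_def sum.distrib distrib_left)

lemma ip_scale_left: "ip X (\<lambda>x. k * a x) c = k * ip X a c"
  by (simp add: ip_def sum_distrib_left mult_ac)

lemma ip_scale_right: "ip X c (\<lambda>x. k * a x) = cnj k * ip X c a"
  by (simp add: ip_def sum_distrib_left mult_ac)

lemma contract_add: "contract X T (\<lambda>x. a x + b x) = (\<lambda>y. contract X T a y + contract X T b y)"
  by (auto simp: contract_def sum.distrib distrib_right)

lemma contract_scale: "contract X T (\<lambda>x. k * a x) = (\<lambda>y. k * contract X T a y)"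
  by (auto simp: contract_def sum_distrib_left mult_ac)

lemma norm2_scale: "norm2 X (\<lambda>x. k * a x) = (cmod k)\<^sup>2 * norm2 X a"
  by (simp add: norm2_def norm_mult power_mult_distrib sum_distrib_left)

lemma norm2_add:
  "norm2 X (\<lambda>x. a x + z * b x) = norm2 X a + 2 * Re (cnj z * ip X a b) + (cmod z)\<^sup>2 * norm2 X b"
proof -
  have "(cmod (p + z * q))\<^sup>2 = (cmod p)\<^sup>2 + 2 * Re (cnj z * (p * cnj q)) + (cmod z)\<^sup>2 * (cmod q)\<^sup>2" for p q
    by (simp add: cmod_power2) (simp add: power2_eq_square algebra_simps)
  then show ?thesis
    by (simp add: norm2_def ip_def sum.distrib sum_distrib_left)
qed

lemma norm2_eq_0: "finite X \<Longrightarrow> norm2 X a = 0 \<Longrightarrow> x \<in> X \<Longrightarrow> a x = 0"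
  unfolding norm2_def by (subst (asm) sum_nonneg_eq_0_iff) auto

lemma contract_norm2_0: "finite X \<Longrightarrow> norm2 X a = 0 \<Longrightarrow> contract X T a y = 0"
  unfolding contract_def by (intro sum.neutral) (auto dest: norm2_eq_0)

lemma norm2_normalize:
  assumes "norm2 X a \<noteq> 0"
  shows "norm2 X (\<lambda>x. of_real (1 / sqrt (norm2 X a)) * a x) = 1"
  unfolding norm2_scale norm_of_real power2_abs
  using assms norm2_nonneg[of X a] by (simp add: power_divide)

text \<open>A top singular vector of \<open>T\<close> on the orthogonal complement of
  \<open>c\<close>, obtained by compactness of the unit sphere; \<open>c = 0\<close> imposes no
  constraint.\<close>

lemma maximizer_exists:
  fixes c :: "'a vect"
  assumes X: "finite X" and a: "norm2 X a = 1" "ip X a c = 0"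
  shows "\<exists>e. norm2 X e = 1 \<and> ip X e c = 0 \<and>
     (\<forall>v. ip X v c = 0 \<longrightarrow> norm2 Y (contract X T v) \<le> norm2 Y (contract X T e) * norm2 X v)"
proof -
  \<comment> \<open>Vectors are functions on the whole type. Compactness needs them fixed to 0
    outside \<open>X\<close>, and \<open>cut\<close> brings any vector into this form.\<close>
  define S where "S = (\<lambda>x. if x \<in> X then cball (0::complex) 1 else {0})"
  define K where "K = (Pi\<^sub>E UNIV S) \<inter> ({v. norm2 X v = 1} \<inter> {v. ip X v c = 0})"
  have "compactin (product_topology (\<lambda>i. euclidean) UNIV) (Pi\<^sub>E UNIV S)"
    unfolding compactin_PiE by (auto simp: S_def)
  then have "compact (Pi\<^sub>E UNIV S)"
    by (simp add: euclidean_product_topology)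
  moreover have "closed {v. norm2 X v = 1}" "closed {v. ip X v c = 0}"
    unfolding norm2_def ip_def
    by (intro closed_Collect_eq continuous_intros continuous_on_product_coordinates)+
  ultimately have "compact K" unfolding K_def by (intro compact_Int_closed closed_Int)
  define cut where "cut = (\<lambda>v x. if x \<in> X then v x else 0 :: complex)"
  have cut: "norm2 X (cut v) = norm2 X v" "ip X (cut v) d = ip X v d" "contract X T (cut v) = contract X T v" for v d
    by (auto simp: cut_def norm2_def ip_def contract_def intro!: sum.cong)
  have cutK: "cut v \<in> K" if "norm2 X v = 1" "ip X v c = 0" for v
  proof -
    have "cmod (v x) \<le> 1" if "x \<in> X" for x
    proof -
      have "(cmod (v x))\<^sup>2 \<le> norm2 X v" unfolding norm2_def
        using that X by (intro member_le_sum) auto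
      then show ?thesis using \<open>norm2 X v = 1\<close> by (simp add: power_le_one_iff abs_square_le_1)
    qed
    then show ?thesis unfolding K_def using that cut by (auto simp: S_def cut_def)
  qed
  have "continuous_on K (\<lambda>v. norm2 Y (contract X T v))"
    unfolding norm2_def contract_def
    by (intro continuous_intros continuous_on_subset[OF continuous_on_product_coordinates]) auto
  then obtain e where e: "e \<in> K" "\<And>v. v \<in> K \<Longrightarrow> norm2 Y (contract X T v) \<le> norm2 Y (contract X T e)"
    using continuous_attains_sup[OF \<open>compact K\<close>, of "\<lambda>v. norm2 Y (contract X T v)"] cutK[OF a] by blast
  have "norm2 Y (contract X T v) \<le> norm2 Y (contract X T e) * norm2 X v" if v: "ip X v c = 0" for v
  proof (cases "norm2 X v = 0")
    case True
    then show ?thesis using X by (simp add: contract_norm2_0 norm2_def[of Y])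
  next
    case False
    define k where "k = complex_of_real (1 / sqrt (norm2 X v))"
    have "cut (\<lambda>x. k * v x) \<in> K"
    proof (rule cutK)
      show "norm2 X (\<lambda>x. k * v x) = 1" unfolding k_def by (rule norm2_normalize[OF False])
      show "ip X (\<lambda>x. k * v x) c = 0" by (simp only: ip_scale_left v mult_zero_right)
    qed
    then have "norm2 Y (contract X T (\<lambda>x. k * v x)) \<le> norm2 Y (contract X T e)"
      using e(2) cut(3) by metis
    moreover have "(cmod k)\<^sup>2 = 1 / norm2 X v"
      using norm2_nonneg[of X v] by (simp add: k_def norm_divide power_divide)
    ultimately show ?thesis
      using False norm2_nonneg[of X v] by (simp add: contract_scale norm2_scale field_simps)
  qed
  then show ?thesis using e(1) by (auto simp: K_def)
qed

text \<open>The first variation at the maximum vanishes. This is the eigenvector equation of the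
  adjoint of \<open>T\<close> times \<open>T\<close>, tested on vectors orthogonal to
  \<open>c\<close>.\<close>

lemma maximizer_stationary:
  assumes e: "norm2 X e = 1" "ip X e c = 0"
    and max: "\<And>v. ip X v c = 0 \<Longrightarrow> norm2 Y (contract X T v) \<le> norm2 Y (contract X T e) * norm2 X v"
    and v: "ip X v c = 0"
  shows "ip Y (contract X T e) (contract X T v) = of_real (norm2 Y (contract X T e)) * ip X e v"
proof -
  define l where "l = norm2 Y (contract X T e)"
  define k where "k = of_real l * ip X e v - ip Y (contract X T e) (contract X T v)"
  define g where "g = l * norm2 X v - norm2 Y (contract X T v)"
  have quad: "0 \<le> 2 * Re (cnj z * k) + (cmod z)\<^sup>2 * g" for z
  proof -
    have "ip X (\<lambda>x. e x + z * v x) c = 0" using e v by (simp add: ip_add_left ip_scale_left)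
    from max[OF this]
    have "norm2 Y (contract X T e) + 2 * Re (cnj z * ip Y (contract X T e) (contract X T v)) + (cmod z)\<^sup>2 * norm2 Y (contract X T v)
      \<le> l * (1 + 2 * Re (cnj z * ip X e v) + (cmod z)\<^sup>2 * norm2 X v)"
      by (simp only: contract_add contract_scale norm2_add e l_def)
    moreover have "Re (cnj z * k) = l * Re (cnj z * ip X e v) - Re (cnj z * ip Y (contract X T e) (contract X T v))"
      by (simp add: k_def algebra_simps)
    ultimately show ?thesis by (simp add: g_def l_def algebra_simps)
  qed
  \<comment> \<open>The inequality \<open>quad\<close> is tested at \<open>z = - t * k\<close>, with
    \<open>t\<close> so small that the linear term dominates.\<close>
  define t where "t = 1 / (1 + \<bar>g\<bar>)"
  have t: "t > 0" "t * g \<le> 1" by (auto simp: t_def divide_simps)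
  have "0 \<le> 2 * Re (cnj (- of_real t * k) * k) + (cmod (- of_real t * k))\<^sup>2 * g" by (rule quad)
  also have "Re (cnj (- of_real t * k) * k) = - t * (cmod k)\<^sup>2"
    by (simp add: cmod_power2) (simp add: power2_eq_square algebra_simps)
  also have "(cmod (- of_real t * k))\<^sup>2 = t\<^sup>2 * (cmod k)\<^sup>2"
    by (simp add: norm_mult power_mult_distrib)
  finally have "0 \<le> (t * (cmod k)\<^sup>2) * (t * g - 2)"
    by (simp add: power2_eq_square algebra_simps)
  moreover have "t * g - 2 < 0" using t by simp
  ultimately have "t * (cmod k)\<^sup>2 \<le> 0" by (simp add: zero_le_mult_iff)
  then have "(cmod k)\<^sup>2 \<le> 0" using t(1) by (simp add: mult_le_0_iff)
  then have "k = 0" by simp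
  then show ?thesis by (simp add: k_def l_def)
qed

text \<open>Entanglement gives \<open>m > 0\<close>: if \<open>T\<close> annihilated the complement
  of \<open>e0\<close>, all functionals \<open>bil X Y T a\<close> would be multiples of a single
  one and hence parallel.\<close>

lemma two_singular_vectors:
  assumes X: "finite X" and Y: "finite Y" and ent: "\<not> parallel (bil X Y T a1) (bil X Y T a2)"
  shows "\<exists>e0 e1 l m. norm2 X e0 = 1 \<and> norm2 X e1 = 1 \<and> ip X e0 e1 = 0 \<and> 0 < m \<and> m \<le> l \<and>
     (\<forall>v. ip Y (contract X T e0) (contract X T v) = of_real l * ip X e0 v) \<and>
     (\<forall>v. ip Y (contract X T e1) (contract X T v) = of_real m * ip X e1 v)"
proof -
  have "norm2 X a1 \<noteq> 0"
  proof
    assume "norm2 X a1 = 0"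
    then have "bil X Y T a1 b = 0" for b using X by (simp add: bil_contract contract_norm2_0)
    then show False using ent parallel_zero by metis
  qed
  from maximizer_exists[OF X norm2_normalize[OF this], of "\<lambda>_. 0" Y T]
  obtain e0 where e0: "norm2 X e0 = 1"
    and max0: "\<And>v. norm2 Y (contract X T v) \<le> norm2 Y (contract X T e0) * norm2 X v"
    by (auto simp: ip_def)
  have st0: "ip Y (contract X T e0) (contract X T v) = of_real (norm2 Y (contract X T e0)) * ip X e0 v" for v
    by (rule maximizer_stationary[where c = "\<lambda>_. 0"]) (use e0 max0 in \<open>auto simp: ip_def\<close>)
  define pr where "pr = (\<lambda>a x. a x + (- ip X a e0) * e0 x)"
  have pr: "ip X (pr a) e0 = 0" for a
    unfolding pr_def ip_add_left ip_scale_left by (simp add: ip_self e0)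
  have "\<exists>a. \<exists>y\<in>Y. contract X T (pr a) y \<noteq> 0"
  proof (rule ccontr)
    assume "\<not> ?thesis"
    then have zero: "contract X T (pr a) y = 0" if "y \<in> Y" for a y
      using that by blast
    have "contract X T (pr a) y = contract X T a y + (- ip X a e0) * contract X T e0 y" for a y
      by (simp only: pr_def contract_add contract_scale)
    then have multiple: "contract X T a y = ip X a e0 * contract X T e0 y" if "y \<in> Y" for a y
      using zero[OF that, of a] by simp
    have "bil X Y T a b = ip X a e0 * (\<Sum>y\<in>Y. contract X T e0 y * b y)" for a b
      unfolding bil_contract sum_distrib_left
    proof (rule sum.cong[OF refl])
      fix y assume "y \<in> Y"
      from multiple[OF this, of a]
      show "contract X T a y * b y = ip X a e0 * (contract X T e0 y * b y)" by simp
    qed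
    then show False using ent by (simp add: parallel_def)
  qed
  then obtain v y where v: "ip X v e0 = 0" "y \<in> Y" "contract X T v y \<noteq> 0" using pr by blast
  then have v0: "norm2 X v \<noteq> 0" using X contract_norm2_0 by metis
  have "ip X (\<lambda>x. of_real (1 / sqrt (norm2 X v)) * v x) e0 = 0"
    by (simp only: ip_scale_left v(1) mult_zero_right)
  from maximizer_exists[OF X norm2_normalize[OF v0] this, of Y T]
  obtain e1 where e1: "norm2 X e1 = 1" "ip X e1 e0 = 0"
    and max1: "\<And>v. ip X v e0 = 0 \<Longrightarrow> norm2 Y (contract X T v) \<le> norm2 Y (contract X T e1) * norm2 X v"
    by blast
  define l m where "l = norm2 Y (contract X T e0)" and "m = norm2 Y (contract X T e1)"
  have e01: "ip X e0 e1 = 0" using e1(2) cnj_ip[of X e1 e0] by simp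
  have "m \<noteq> 0"
  proof
    assume "m = 0"
    then have "norm2 Y (contract X T v) = 0"
      using max1[OF v(1)] norm2_nonneg[of Y "contract X T v"] by (simp add: m_def)
    then show False using norm2_eq_0[OF Y] v by metis
  qed
  then have "0 < m" using norm2_nonneg[of Y "contract X T e1"] by (simp add: m_def)
  moreover have "m \<le> l" using max0[of e1] e1 by (simp add: l_def m_def)
  \<comment> \<open>Maximality of \<open>e1\<close> gives this only for vectors orthogonal to
    \<open>e0\<close>; the component along \<open>e0\<close> is covered by
    \<open>st0\<close>.\<close>
  moreover have "ip Y (contract X T e1) (contract X T v) = of_real m * ip X e1 v" for v
  proof -
    have "ip Y (contract X T e1) (contract X T (pr v)) = of_real m * ip X e1 (pr v)"
      unfolding m_def by (rule maximizer_stationary[OF e1 max1 pr])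
    moreover have "ip Y (contract X T e1) (contract X T e0) = 0"
      using st0[of e1] e01 cnj_ip[of Y "contract X T e0" "contract X T e1"] by simp
    ultimately show ?thesis
      unfolding pr_def contract_add contract_scale ip_add_right ip_scale_right by (simp add: e1(2))
  qed
  ultimately show ?thesis using e0 e1(1) e01 st0 unfolding l_def by blast
qed

text \<open>\<open>u s\<close> is the coefficient of \<open>e0\<close> in the unnormalized vector
  \<open>e1 + u s * e0\<close> of step \<open>s\<close>. Exact steering multiplies it by
  \<open>l / m\<close>; the overshoot \<open>1 / k\<close> gets the ladder away from 0 and keeps it
  moving if \<open>l = m\<close>. Step \<open>s\<close> costs at most
  \<open>m / (k^2 + (s + 1)^2)\<close>, in total at most \<open>2 * m / k\<close>, and
  \<open>k^2\<close> steps reach \<open>u >= k\<close>, where the last term is at most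
  \<open>m / k\<close>.\<close>

lemma ladder_steps_bound:
  fixes l m :: real and k :: nat
  assumes m: "0 < m" "m \<le> l" and k: "0 < k"
  defines "u \<equiv> rec_nat 0 (\<lambda>_ t. l / m * t + 1 / real k)"
  shows "(\<Sum>s<k\<^sup>2. (l * u s - m * u (Suc s))\<^sup>2 / ((1 + (u (Suc s))\<^sup>2) * (l * (u s)\<^sup>2 + m)))
     + m / (1 + (u (k\<^sup>2))\<^sup>2) \<le> 3 * m / k"
proof -
  have u: "u 0 = 0" "u (Suc s) = l / m * u s + 1 / k" for s by (simp_all add: u_def)
  have us: "real s / k \<le> u s" for s
  proof (induction s)
    case (Suc s)
    then have "1 * (real s / k) \<le> l / m * u s" using m by (intro mult_mono) auto
    then show ?case by (simp add: u add_divide_distrib)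
  qed (simp add: u)
  have step: "(l * u s - m * u (Suc s))\<^sup>2 / ((1 + (u (Suc s))\<^sup>2) * (l * (u s)\<^sup>2 + m))
      \<le> 2 * m * (1 / (real k + s) - 1 / (real k + Suc s))" for s
  proof -
    have num: "(l * u s - m * u (Suc s))\<^sup>2 = (m / k)\<^sup>2" using m by (simp add: u field_simps)
    have "(real (Suc s) / k)\<^sup>2 \<le> (u (Suc s))\<^sup>2" using us[of "Suc s"] by (intro power_mono) auto
    then have "(1 + (real (Suc s) / k)\<^sup>2) * m \<le> (1 + (u (Suc s))\<^sup>2) * (l * (u s)\<^sup>2 + m)"
      using m by (intro mult_mono) (auto intro: add_nonneg_nonneg)
    moreover have "0 < (1 + (real (Suc s) / k)\<^sup>2) * m"
      using m by (intro mult_pos_pos) (auto intro: add_pos_nonneg)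
    ultimately have "(m / k)\<^sup>2 / ((1 + (u (Suc s))\<^sup>2) * (l * (u s)\<^sup>2 + m))
        \<le> (m / k)\<^sup>2 / ((1 + (real (Suc s) / k)\<^sup>2) * m)"
      by (intro divide_left_mono) auto
    also have "\<dots> = m / ((real k)\<^sup>2 + (real (Suc s))\<^sup>2)"
    proof -
      have "1 + (real (Suc s) / k)\<^sup>2 = ((real k)\<^sup>2 + (real (Suc s))\<^sup>2) / (real k)\<^sup>2"
        using k by (simp add: power_divide add_divide_distrib del: of_nat_Suc)
      then show ?thesis using m k by (simp add: power_divide power2_eq_square)
    qed
    \<comment> \<open>The sum of squares is traded for a product of consecutive terms, so that the
      bounds telescope.\<close>
    also have "\<dots> \<le> m / ((real k + s) * (real k + Suc s) / 2)"
    proof (intro divide_left_mono)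
      have "(p + q)\<^sup>2 \<le> 2 * (p\<^sup>2 + q\<^sup>2)" for p q :: real
        using sum_squares_bound[of p q] by (simp add: power2_sum)
      then have "(real k + Suc s)\<^sup>2 \<le> 2 * ((real k)\<^sup>2 + (real (Suc s))\<^sup>2)" .
      moreover have "(real k + s) * (real k + Suc s) \<le> (real k + Suc s)\<^sup>2"
        unfolding power2_eq_square by (intro mult_right_mono) auto
      moreover have "p / 2 \<le> r" if "q \<le> 2 * r" "p \<le> q" for p q r :: real
        using that by linarith
      ultimately show "(real k + s) * (real k + Suc s) / 2 \<le> (real k)\<^sup>2 + (real (Suc s))\<^sup>2"
        by blast
    qed (use m k in \<open>auto intro!: mult_pos_pos add_pos_nonneg\<close>)
    also have "\<dots> = 2 * m * (1 / (real k + s) - 1 / (real k + Suc s))"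
      using k by (simp add: field_simps)
    finally show ?thesis unfolding num .
  qed
  have "(\<Sum>s<k\<^sup>2. (l * u s - m * u (Suc s))\<^sup>2 / ((1 + (u (Suc s))\<^sup>2) * (l * (u s)\<^sup>2 + m)))
     \<le> (\<Sum>s<k\<^sup>2. 2 * m * (1 / (real k + s) - 1 / (real k + Suc s)))"
    by (rule sum_mono) (rule step)
  also have "\<dots> = 2 * m * (1 / (real k + 0) - 1 / (real k + k\<^sup>2))"
    unfolding sum_distrib_left[symmetric]
    using sum_lessThan_telescope'[of "\<lambda>s. 1 / (real k + real s)" "k\<^sup>2"] by simp
  also have "\<dots> \<le> 2 * m / k" using m k by (simp add: right_diff_distrib)
  finally have sum: "(\<Sum>s<k\<^sup>2. (l * u s - m * u (Suc s))\<^sup>2 / ((1 + (u (Suc s))\<^sup>2) * (l * (u s)\<^sup>2 + m)))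
     \<le> 2 * m / k" .
  have "real k \<le> u (k\<^sup>2)" using us[of "k\<^sup>2"] k by (simp add: power2_eq_square)
  then have "(real k)\<^sup>2 \<le> (u (k\<^sup>2))\<^sup>2" by (intro power_mono) auto
  moreover have "real k \<le> (real k)\<^sup>2" using k by (simp add: power2_eq_square)
  ultimately have "real k \<le> 1 + (u (k\<^sup>2))\<^sup>2" by linarith
  then have "m / (1 + (u (k\<^sup>2))\<^sup>2) \<le> m / k"
    using m k by (intro divide_left_mono) (auto intro!: mult_pos_pos add_pos_nonneg)
  with sum show ?thesis by (simp add: add_divide_distrib[symmetric])
qed

text \<open>The quantum counterpart of \<open>ladder_defect\<close> for amplitudes \<open>F\<close>:
  each difference is a failure probability as in \<open>quad_complement\<close>.\<close>

definition ladder_error ::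
  "'a set \<Rightarrow> 'b set \<Rightarrow> ('a vect \<Rightarrow> 'b vect \<Rightarrow> complex) \<Rightarrow> nat \<Rightarrow> (nat \<Rightarrow> 'a vect) \<Rightarrow> (nat \<Rightarrow> 'b vect) \<Rightarrow> real" where
  "ladder_error X Y F N a b =
     (\<Sum>s<N. ((\<Sum>y\<in>Y. (cmod (F (a s) (ket y)))\<^sup>2) - (cmod (F (a s) (b (Suc s))))\<^sup>2)
         + ((\<Sum>x\<in>X. (cmod (F (ket x) (b (Suc s))))\<^sup>2) - (cmod (F (a (Suc s)) (b (Suc s))))\<^sup>2))
     + (cmod (F (a N) (b 0)))\<^sup>2"

text \<open>
  If \<open>T\<close> is diagonal with squared singular values \<open>l \<ge> m\<close> on the span of \<open>e0\<close>, \<open>e1\<close>, the vectors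
  \<open>a s\<close> move from \<open>e1\<close> towards \<open>e0\<close>. Conditioned on \<open>a s\<close>, the second party is left in the state
  \<open>b (Suc s)\<close>, which in turn steers the first party towards \<open>e0\<close>, hence almost to \<open>a (Suc s)\<close>. For
  \<open>l = m\<close> this is the chained Bell inequality and for \<open>l > m\<close> essentially Hardy's ladder.
\<close>

lemma ladder_vectors:
  assumes X: "finite X" and Y: "finite Y" and ent: "\<not> parallel (bil X Y T a1) (bil X Y T a2)"
  shows "\<exists>a0 b0. norm2 X a0 = 1 \<and> norm2 Y b0 = 1 \<and> bil X Y T a0 b0 \<noteq> 0 \<and>
    (\<forall>\<epsilon>>0. \<exists>N a b. a 0 = a0 \<and> b 0 = b0 \<and> (\<forall>s. norm2 X (a s) = 1 \<and> norm2 Y (b s) = 1) \<and>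
      ladder_error X Y (bil X Y T) N a b < \<epsilon>)"
proof -
  obtain e0 e1 l m where e: "norm2 X e0 = 1" "norm2 X e1 = 1" "ip X e0 e1 = 0" and m: "0 < m" "m \<le> l"
    and h0: "\<And>v. ip Y (contract X T e0) (contract X T v) = of_real l * ip X e0 v"
    and h1: "\<And>v. ip Y (contract X T e1) (contract X T v) = of_real m * ip X e1 v"
    using two_singular_vectors[OF assms] by blast
  have e10: "ip X e1 e0 = 0" using e(3) cnj_ip[of X e0 e1] by simp
  define w where "w = (\<lambda>(u::real) x. e1 x + of_real u * e0 x)"
  define A where "A = (\<lambda>u x. of_real (1 / sqrt (1 + u\<^sup>2)) * w u x)"
  define \<rho> where "\<rho> = (\<lambda>u::real. l * u\<^sup>2 + m)"
  \<comment> \<open>The conjugate turns \<open>bil\<close> into an inner product with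
    \<open>contract X T (w u)\<close>, the state steered by \<open>w u\<close>, whose squared norm
    is \<open>\<rho> u\<close>.\<close>
  define Bv where "Bv = (\<lambda>u y. of_real (1 / sqrt (\<rho> u)) * cnj (contract X T (w u) y))"
  have rho: "\<rho> u > 0" for u unfolding \<rho>_def using m by (intro add_nonneg_pos mult_nonneg_nonneg) auto
  have u1: "1 + u\<^sup>2 > 0" for u :: real by (intro add_pos_nonneg) auto
  have h: "ip Y (contract X T (w u)) (contract X T v) = of_real m * ip X e1 v + of_real (u * l) * ip X e0 v" for u v
    unfolding w_def contract_add contract_scale ip_add_left ip_scale_left h0 h1 by simp
  have normw: "norm2 X (w u) = 1 + u\<^sup>2" for u
    unfolding w_def norm2_add by (simp add: e e10)
  have "complex_of_real (norm2 Y (contract X T (w u))) = of_real (\<rho> u)" for u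
    unfolding ip_self[symmetric] h
    by (simp add: w_def ip_add_right ip_scale_right ip_self e e10 \<rho>_def power2_eq_square algebra_simps)
  then have norm_contract: "norm2 Y (contract X T (w u)) = \<rho> u" for u by (simp only: of_real_eq_iff)
  have normA: "norm2 X (A u) = 1" for u
    using norm2_normalize[of X "w u"] u1[of u] unfolding normw A_def by simp
  have normB: "norm2 Y (Bv u) = 1" for u
  proof -
    have "norm2 Y (\<lambda>y. cnj (contract X T (w u) y)) = \<rho> u"
      using norm_contract[of u] by (simp add: norm2_def)
    then show ?thesis
      using norm2_normalize[of Y "\<lambda>y. cnj (contract X T (w u) y)"] rho[of u] unfolding Bv_def by simp
  qed
  have bil_B: "bil X Y T a (Bv u) = of_real (1 / sqrt (\<rho> u)) * cnj (of_real m * ip X e1 a + of_real (u * l) * ip X e0 a)"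
    for a u
  proof -
    have "bil X Y T a (Bv u) = of_real (1 / sqrt (\<rho> u)) * ip Y (contract X T a) (contract X T (w u))"
      by (simp add: bil_contract Bv_def ip_def sum_distrib_left mult_ac)
    then show ?thesis by (subst (asm) cnj_ip[symmetric]) (simp only: h)
  qed
  have e1w: "ip X e1 (w u) = 1" and e0w: "ip X e0 (w u) = of_real u" for u
    unfolding w_def ip_add_right ip_scale_right by (simp_all add: ip_self e e10)
  have bil_AB: "(cmod (bil X Y T (A u') (Bv u)))\<^sup>2 = (m + l * u * u')\<^sup>2 / ((1 + u'\<^sup>2) * \<rho> u)" for u u'
  proof -
    have "bil X Y T (A u') (Bv u) = of_real (1 / sqrt (\<rho> u) * (1 / sqrt (1 + u'\<^sup>2)) * (m + l * u * u'))"
      unfolding bil_B A_def ip_scale_right e1w e0w by (simp add: algebra_simps add_divide_distrib)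
    then show ?thesis
      using rho[of u] u1[of u'] by (simp only: norm_of_real power2_abs) (simp add: power_mult_distrib power_divide less_imp_le)
  qed
  have sum_A: "(\<Sum>y\<in>Y. (cmod (bil X Y T (A u) (ket y)))\<^sup>2) = \<rho> u / (1 + u\<^sup>2)" for u
  proof -
    have "bil X Y T a (ket y) = contract X T a y" if "y \<in> Y" for a y
    proof -
      have "bil X Y T a (ket y) = (\<Sum>z\<in>Y. if z = y then contract X T a z else 0)"
        unfolding bil_contract by (intro sum.cong) (auto simp: ket_def)
      then show ?thesis using Y that by simp
    qed
    then have "(\<Sum>y\<in>Y. (cmod (bil X Y T (A u) (ket y)))\<^sup>2) = norm2 Y (contract X T (A u))"
      by (simp add: norm2_def)
    then show ?thesis
      unfolding A_def contract_scale norm2_scale norm_contract norm_of_real power2_abs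
      using u1[of u] by (simp add: power_divide less_imp_le)
  qed
  have sum_B: "(\<Sum>x\<in>X. (cmod (bil X Y T (ket x) (Bv u)))\<^sup>2) = (m\<^sup>2 + (l * u)\<^sup>2) / \<rho> u" for u
  proof -
    have ip_ket: "ip X c (ket x) = c x" if "x \<in> X" for c x
    proof -
      have "ip X c (ket x) = (\<Sum>z\<in>X. if z = x then c z else 0)"
        unfolding ip_def by (intro sum.cong) (auto simp: ket_def)
      then show ?thesis using X that by simp
    qed
    have "(\<Sum>x\<in>X. (cmod (bil X Y T (ket x) (Bv u)))\<^sup>2)
        = (\<Sum>x\<in>X. 1 / \<rho> u * (cmod (of_real m * e1 x + of_real (u * l) * e0 x))\<^sup>2)"
      unfolding bil_B
      by (intro sum.cong refl) (use rho[of u] in \<open>simp add: ip_ket norm_mult norm_divide power_mult_distrib power_divide less_imp_le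
          del: complex_cnj_add complex_cnj_mult of_real_mult\<close>)
    also have "\<dots> = 1 / \<rho> u * norm2 X (\<lambda>x. of_real m * e1 x + of_real (u * l) * e0 x)"
      by (simp only: norm2_def sum_distrib_left)
    also have "norm2 X (\<lambda>x. of_real m * e1 x + of_real (u * l) * e0 x) = m\<^sup>2 + (l * u)\<^sup>2"
      unfolding norm2_add norm2_scale ip_scale_left e10 by (simp add: e power_mult_distrib mult.commute flip: of_real_mult)
    finally show ?thesis by simp
  qed
  have "norm2 X (A 0) = 1 \<and> norm2 Y (Bv 0) = 1 \<and> bil X Y T (A 0) (Bv 0) \<noteq> 0"
    using bil_AB[of 0 0] rho[of 0] m by (auto simp: normA normB)
  moreover have "\<exists>N a b. a 0 = A 0 \<and> b 0 = Bv 0 \<and> (\<forall>s. norm2 X (a s) = 1 \<and> norm2 Y (b s) = 1) \<and>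
      ladder_error X Y (bil X Y T) N a b < \<epsilon>" if eps: "\<epsilon> > 0" for \<epsilon> :: real
  proof -
    obtain k :: nat where k: "3 * m / \<epsilon> < real k" using reals_Archimedean2 by blast
    then have "0 < real k" using m eps by (smt (verit) divide_pos_pos)
    then have k0: "0 < k" by simp
    have k3: "3 * m / k < \<epsilon>" using k \<open>0 < real k\<close> eps by (simp add: field_simps)
    define u where "u = rec_nat 0 (\<lambda>_ t. l / m * t + 1 / real k)"
    define a where "a = (\<lambda>s. A (u s))"
    \<comment> \<open>The second party lags by one step. Truncated subtraction gives
      \<open>b 0 = b 1\<close>, the vector steered by \<open>a 0\<close>, independent of
      \<open>k\<close>.\<close>
    define b where "b = (\<lambda>s. Bv (u (s - 1)))"
    have err: "((\<Sum>y\<in>Y. (cmod (bil X Y T (a s) (ket y)))\<^sup>2) - (cmod (bil X Y T (a s) (b (Suc s))))\<^sup>2)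
         + ((\<Sum>x\<in>X. (cmod (bil X Y T (ket x) (b (Suc s))))\<^sup>2) - (cmod (bil X Y T (a (Suc s)) (b (Suc s))))\<^sup>2)
       = (l * u s - m * u (Suc s))\<^sup>2 / ((1 + (u (Suc s))\<^sup>2) * (l * (u s)\<^sup>2 + m))" for s
    proof -
      \<comment> \<open>Steering is exact here, so the first difference in \<open>err\<close> is
        zero and the second carries the whole cost of the step.\<close>
      have "m + l * u s * u s = \<rho> (u s)" by (simp add: \<rho>_def power2_eq_square)
      then have 1: "(cmod (bil X Y T (a s) (b (Suc s))))\<^sup>2 = \<rho> (u s) / (1 + (u s)\<^sup>2)"
        using rho[of "u s"] by (simp add: a_def b_def bil_AB) (simp add: power2_eq_square)
      \<comment> \<open>Lagrange's identity for the vectors \<open>(m, l * p)\<close> and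
        \<open>(1, q)\<close>.\<close>
      have 2: "(m\<^sup>2 + (l * p)\<^sup>2) / r - (m + l * p * q)\<^sup>2 / ((1 + q\<^sup>2) * r) = (l * p - m * q)\<^sup>2 / ((1 + q\<^sup>2) * r)"
        if "r > 0" for p q r :: real
      proof -
        have frac: "(m\<^sup>2 + (l * p)\<^sup>2) / r = (m\<^sup>2 + (l * p)\<^sup>2) * (1 + q\<^sup>2) / ((1 + q\<^sup>2) * r)"
          using u1[of q] that by simp
        have "(m\<^sup>2 + (l * p)\<^sup>2) * (1 + q\<^sup>2) - (m + l * p * q)\<^sup>2 = (l * p - m * q)\<^sup>2"
          by (simp add: power2_eq_square algebra_simps)
        then show ?thesis by (simp only: frac diff_divide_distrib[symmetric])
      qed
      show ?thesis
        unfolding 1 by (simp add: a_def b_def sum_A sum_B bil_AB 2[OF rho]) (simp add: \<rho>_def)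
    qed
    have fin: "(cmod (bil X Y T (a (k\<^sup>2)) (Bv 0)))\<^sup>2 = m / (1 + (u (k\<^sup>2))\<^sup>2)"
      using m by (simp add: a_def bil_AB \<rho>_def) (simp add: power2_eq_square)
    have "b 0 = Bv 0" by (simp add: b_def u_def)
    then have "ladder_error X Y (bil X Y T) (k\<^sup>2) a b < \<epsilon>"
      unfolding ladder_error_def using ladder_steps_bound[OF m k0] k3
      by (simp only: err fin u_def)
    moreover have "a 0 = A 0" "b 0 = Bv 0" by (simp_all add: a_def b_def u_def)
    moreover have "\<forall>s. norm2 X (a s) = 1 \<and> norm2 Y (b s) = 1" by (simp add: a_def b_def normA normB)
    ultimately show ?thesis by blast
  qed
  ultimately show ?thesis by blast
qed

section \<open>Assembling the measurements\<close>

lemma multi_eval_scale_all: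
  "multi_eval I B \<Psi> (\<lambda>i x. k i * w i x) = (\<Prod>i\<in>I. k i) * multi_eval I B \<Psi> w"
  by (simp add: multi_eval_def prod.distrib sum_distrib_left mult_ac)

lemma multi_eval_zero:
  assumes "finite I" "i \<in> I" "finite (B i)" "norm2 (B i) (w i) = 0"
  shows "multi_eval I B \<Psi> w = 0"
  unfolding multi_eval_def
proof (intro sum.neutral ballI)
  fix x assume "x \<in> Pi\<^sub>E I B"
  then have "w i (x i) = 0" using norm2_eq_0[OF assms(3,4)] assms(2) by (auto simp: PiE_iff)
  then show "(\<Prod>i\<in>I. w i (x i)) * \<Psi> x = 0" using assms(1,2) by auto
qed

text \<open>A null vector at a party off the edge would make all amplitudes zero, hence parallel. So
  these vectors can be normalized, which multiplies all amplitudes by one nonzero constant \<kappa>,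
  and multilinearity presents them as a bilinear form on the pair.\<close>

lemma linked_ladder:
  assumes I: "finite I" and B: "\<And>i. i \<in> I \<Longrightarrow> finite (B i)" and link: "linked I B \<Psi> u v w"
  shows "\<exists>r a0 b0. (\<forall>i\<in>I - {u, v}. norm2 (B i) (r i) = 1) \<and> norm2 (B u) a0 = 1 \<and> norm2 (B v) b0 = 1 \<and>
     multi_eval I B \<Psi> (r(u := a0, v := b0)) \<noteq> 0 \<and>
     (\<forall>\<epsilon>>0. \<exists>N a b. a 0 = a0 \<and> b 0 = b0 \<and> (\<forall>s. norm2 (B u) (a s) = 1 \<and> norm2 (B v) (b s) = 1) \<and>
        ladder_error (B u) (B v) (\<lambda>a b. multi_eval I B \<Psi> (r(u := a, v := b))) N a b < \<epsilon>)"
proof -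
  from link obtain a1 a2 where uv: "u \<in> I" "v \<in> I" "u \<noteq> v"
    and ent: "\<not> parallel (\<lambda>t. multi_eval I B \<Psi> (w(u := a1, v := t)))
                        (\<lambda>t. multi_eval I B \<Psi> (w(u := a2, v := t)))"
    unfolding linked_def by blast
  have w0: "norm2 (B i) (w i) \<noteq> 0" if i: "i \<in> I - {u, v}" for i
  proof
    assume "norm2 (B i) (w i) = 0"
    then have "multi_eval I B \<Psi> (w(u := a1, v := t)) = 0" for t
      using i I B by (intro multi_eval_zero[of _ i]) auto
    then show False using ent by (simp add: parallel_def)
  qed
  define k where "k i = (if i \<in> I - {u, v} then complex_of_real (1 / sqrt (norm2 (B i) (w i))) else 1)" for i
  define r where "r = (\<lambda>i x. k i * w i x)"
  have r1: "norm2 (B i) (r i) = 1" if "i \<in> I - {u, v}" for i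
    using norm2_normalize[OF w0[OF that]] that by (simp only: r_def k_def if_True)
  define \<kappa> where "\<kappa> = (\<Prod>i\<in>I. k i)"
  have k0: "k i \<noteq> 0" if "i \<in> I" for i
    using w0[of i] by (auto simp: k_def)
  then have kappa: "\<kappa> \<noteq> 0" using I by (simp add: \<kappa>_def)
  have amp: "multi_eval I B \<Psi> (r(u := a, v := b)) = \<kappa> * multi_eval I B \<Psi> (w(u := a, v := b))" for a b
  proof -
    have "r(u := a, v := b) = (\<lambda>i x. k i * (w(u := a, v := b)) i x)"
      by (auto simp: r_def k_def fun_eq_iff)
    then show ?thesis by (simp only: multi_eval_scale_all \<kappa>_def)
  qed
  define T where "T = (\<lambda>x y. multi_eval I B \<Psi> (r(u := ket x, v := ket y)))"
  have bil: "bil (B u) (B v) T = (\<lambda>a b. multi_eval I B \<Psi> (r(u := a, v := b)))"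
  proof (intro ext)
    fix a b
    have "multi_eval I B \<Psi> (r(u := a, v := b)) = multi_eval I B \<Psi> ((r(v := b))(u := a))"
      by (simp only: fun_upd_twist[OF uv(3), of r a b])
    also have "\<dots> = (\<Sum>x\<in>B u. a x * multi_eval I B \<Psi> (r(u := ket x, v := b)))"
      using uv I B by (subst multi_eval_expand) (simp_all add: fun_upd_twist[OF uv(3)[symmetric], of r b])
    also have "\<dots> = (\<Sum>x\<in>B u. a x * (\<Sum>y\<in>B v. b y * T x y))"
      using uv I B by (intro sum.cong refl, subst multi_eval_expand) (simp_all add: T_def)
    finally show "bil (B u) (B v) T a b = multi_eval I B \<Psi> (r(u := a, v := b))"
      by (simp add: bil_def sum_distrib_left mult_ac)
  qed
  have "\<not> parallel (bil (B u) (B v) T a1) (bil (B u) (B v) T a2)"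
    using ent kappa unfolding bil amp parallel_def by (auto simp: mult_ac)
  from ladder_vectors[OF B[OF uv(1)] B[OF uv(2)] this] r1
  show ?thesis unfolding bil by blast
qed

lemma subprojector_if_eq:
  assumes "projector B S" "\<And>x y. x \<in> B \<Longrightarrow> y \<in> B \<Longrightarrow> S x y = T x y"
  shows "subprojector B S T"
proof -
  have "projector B T" using assms unfolding projector_def by (simp cong: sum.cong)
  moreover have "(\<Sum>y\<in>B. S x y * T y z) = S x z" if "x \<in> B" "z \<in> B" for x z
    using assms that unfolding projector_def by (simp cong: sum.cong)
  ultimately show ?thesis using assms(1) by (simp add: subprojector_def)
qed

lemma projector_complement: "finite B \<Longrightarrow> projector B S \<Longrightarrow> projector B (op_diff ident S)"
  by (intro projector_op_diff subprojector_ident)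

theorem gme_copies_gmnl:
  fixes I :: "'i set" and D :: "'b set" and \<Psi> :: "('i \<Rightarrow> 'b) vect"
  assumes I: "finite I" "I \<noteq> {}" and D: "finite D"
    and state: "pure_state (I \<rightarrow>\<^sub>E D) \<Psi>" and gme: "gme I (\<lambda>_. D) \<Psi>"
  shows "gmnl_state I (\<lambda>_. {1..card I - 1} \<rightarrow>\<^sub>E D) (ket_bra (copies I (card I - 1) \<Psi>))"
proof -
  define C where "C = {1..card I - 1}"
  define K where "K = C \<rightarrow>\<^sub>E D"
  have finC: "finite C" and finK: "finite K" using D by (auto simp: C_def K_def intro!: finite_PiE)
  have "\<exists>u\<in>M. \<exists>v\<in>I - M. \<exists>w. linked I (\<lambda>_. D) \<Psi> u v w" if "M \<in> proper_parts I" for M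
    by (rule cut_crossed_by_link[OF I(1) _ state gme that]) (rule D)
  then have "\<exists>u v w. (\<forall>c\<in>C. linked I (\<lambda>_. D) \<Psi> (u c) (v c) (w c)) \<and>
     (\<forall>M\<in>proper_parts I. \<exists>c\<in>C. (u c \<in> M) \<noteq> (v c \<in> M))"
    unfolding C_def by (rule spanning_links[OF I])
  then obtain u v w where "\<forall>c\<in>C. linked I (\<lambda>_. D) \<Psi> (u c) (v c) (w c)"
    and "\<forall>M\<in>proper_parts I. \<exists>c\<in>C. (u c \<in> M) \<noteq> (v c \<in> M)"
    by (elim exE conjE) (rule that)
  then have link: "\<And>c. c \<in> C \<Longrightarrow> linked I (\<lambda>_. D) \<Psi> (u c) (v c) (w c)"
    and cross: "\<And>M. M \<in> proper_parts I \<Longrightarrow> \<exists>c\<in>C. (u c \<in> M) \<noteq> (v c \<in> M)" by simp_all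
  have uv: "u c \<in> I" "v c \<in> I" "u c \<noteq> v c" if "c \<in> C" for c
    using link[OF that] by (auto simp: linked_def)
  define amp where "amp c r a b = multi_eval I (\<lambda>_. D) \<Psi> (r(u c := a, v c := b))" for c r a b
  define Q where "Q c r a0 b0 \<longleftrightarrow> (\<forall>i\<in>I - {u c, v c}. norm2 D (r i) = 1) \<and> norm2 D a0 = 1 \<and> norm2 D b0 = 1 \<and>
     amp c r a0 b0 \<noteq> 0 \<and>
     (\<forall>\<epsilon>>0. \<exists>N a b. a 0 = a0 \<and> b 0 = b0 \<and> (\<forall>s. norm2 D (a s) = 1 \<and> norm2 D (b s) = 1) \<and>
        ladder_error D D (amp c r) N a b < \<epsilon>)" for c r a0 b0
  have "\<exists>r a0 b0. Q c r a0 b0" if "c \<in> C" for c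
    unfolding Q_def amp_def[abs_def] by (rule linked_ladder[OF I(1) D link[OF that]])
  then obtain r a0 b0 where Q: "\<And>c. c \<in> C \<Longrightarrow> Q c (r c) (a0 c) (b0 c)" by metis
  have r: "norm2 D (r c i) = 1" if "c \<in> C" "i \<in> I - {u c, v c}" for c i
    using Q[OF that(1)] that(2) unfolding Q_def by blast
  have ab0: "amp c (r c) (a0 c) (b0 c) \<noteq> 0" if "c \<in> C" for c
    using Q[OF that] unfolding Q_def by blast
  define p where "p = (\<Prod>c\<in>C. (cmod (amp c (r c) (a0 c) (b0 c)))\<^sup>2)"
  have p0: "p > 0" using ab0 by (auto simp: p_def intro!: prod_pos)
  \<comment> \<open>The \<open>card C\<close> errors must add up to strictly less than
    \<open>p\<close>, hence the extra 1.\<close>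
  define \<epsilon> where "\<epsilon> = p / (card C + 1)"
  have eps: "\<epsilon> > 0" using p0 by (simp add: \<epsilon>_def)
  define L where "L c N a b \<longleftrightarrow> a 0 = a0 c \<and> b 0 = b0 c \<and> (\<forall>s. norm2 D (a s) = 1 \<and> norm2 D (b s) = 1) \<and>
        ladder_error D D (amp c (r c)) N a b < \<epsilon>" for c N a b
  have "\<exists>N a b. L c N a b" if "c \<in> C" for c
    using Q[OF that] eps unfolding Q_def L_def by blast
  then obtain N a b where L: "\<And>c. c \<in> C \<Longrightarrow> L c (N c) (a c) (b c)" by metis
  have ab: "a c 0 = a0 c" "b c 0 = b0 c" "norm2 D (a c s) = 1" "norm2 D (b c s) = 1"
    "ladder_error D D (amp c (r c)) (N c) (a c) (b c) < \<epsilon>" if "c \<in> C" for c s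
    using L[OF that] by (simp_all add: L_def)
  define vec where "vec c i s = (if i = u c then a c s else if i = v c then b c s else r c i)" for c i s
  have proj: "projector D (rank_one (vec c i s))" if "c \<in> C" "i \<in> I" for c i s
  proof (rule projector_rank_one)
    show "(\<Sum>x\<in>D. (cmod (vec c i s x))\<^sup>2) = 1"
      using r[OF that(1), of i] ab(3,4)[OF that(1), of s] that(2)
      unfolding norm2_def by (simp add: vec_def)
  qed
  define x0 where "x0 = prod_encode (0, 0)"
  \<comment> \<open>Step 0 is the same input \<open>x0\<close> for every copy. Steps beyond
    \<open>N c\<close> also fall back to it, so that \<open>h c s\<close> lies in \<open>X\<close>
    for all \<open>s\<close>.\<close>
  define h where "h c s = prod_encode (if s = 0 \<or> N c < s then (0, 0) else (c, s))" for c s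
  define X where "X = insert x0 ((\<lambda>(c, s). prod_encode (c, s)) ` (SIGMA c:C. {..N c}))"
  \<comment> \<open>The input \<open>(c, s)\<close> with \<open>s > 0\<close> is step \<open>s\<close> on copy \<open>c\<close> alone; with \<open>s = 0\<close> it is the bottom step on all copies.\<close>
  define op where "op x i c' = (case prod_decode x of (c, s) \<Rightarrow>
      if s = 0 then rank_one (vec c' i 0) else if c' = c then rank_one (vec c i s) else ident)" for x i c'
  define gd where "gd x i = tensor_op C (op x i)" for x i
  define E where "E i x = (\<lambda>\<alpha>::nat. if \<alpha> = 1 then gd x i else op_diff ident (gd x i))" for i x
  have hX: "h c s \<in> X" if "c \<in> C" for c s
    using that by (auto simp: h_def X_def x0_def)
  have proj_op: "projector D (op x i c')" if "x \<in> X" "i \<in> I" "c' \<in> C" for x i c'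
    using that proj projector_ident[OF D] by (auto simp: op_def X_def x0_def)
  have proj_gd: "projector K (gd x i)" if "x \<in> X" "i \<in> I" for x i
    unfolding gd_def K_def using that finC D proj_op by (intro projector_tensor_op) auto
  have povm: "povm K {0, 1} (E i x)" if "x \<in> X" "i \<in> I" for x i
    unfolding povm_def
    using proj_gd[OF that] finK
    by (auto simp: E_def op_diff_def ident_def intro!: pos_semidef_projector projector_complement[unfolded op_diff_def ident_def])

  define lift where "lift c S = tensor_op C ((\<lambda>_. ident)(c := S))" for c and S :: "'b oper"
  \<comment> \<open>At \<open>s = 0\<close> success concerns all copies and only implies success in
    copy \<open>c\<close>, so this is an inclusion rather than an equality.\<close>
  have gd_lift: "subprojector K (gd (h c s) i) (lift c (rank_one (vec c i s)))"
    if "c \<in> C" "i \<in> I" "s \<le> N c" for c i s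
    unfolding gd_def lift_def K_def
  proof (rule subprojector_tensor_op)
    fix c' assume c': "c' \<in> C"
    show "subprojector D (op (h c s) i c') (((\<lambda>_. ident)(c := rank_one (vec c i s))) c')"
      using that c' proj D by (auto simp: op_def h_def subprojector_refl subprojector_ident projector_ident)
  qed (use finC D in auto)
  \<comment> \<open>At the bottom, failure could come from any copy and would not be controlled by
    copy \<open>c\<close>; hence \<open>s > 0\<close>. The failures in \<open>ladder_defect\<close>
    all occur at steps \<open>Suc s\<close>.\<close>
  have bad_lift: "subprojector K (op_diff ident (gd (h c s) i)) (lift c (op_diff ident (rank_one (vec c i s))))"
    if "c \<in> C" "i \<in> I" "s \<le> N c" "s > 0" for c i s
  proof (rule subprojector_if_eq)
    show "projector K (op_diff ident (gd (h c s) i))"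
      using projector_complement[OF finK] proj_gd hX that by blast
    have op: "op (h c s) i = (\<lambda>_. ident)(c := rank_one (vec c i s))"
      using that by (auto simp: op_def h_def)
    fix x y assume "x \<in> K" "y \<in> K"
    moreover have "(\<lambda>_::nat. ident)(c := ident) = (\<lambda>_. ident :: 'b oper)" by auto
    ultimately have "tensor_op C ((\<lambda>_. ident)(c := ident)) x y = ident x y"
      using tensor_op_ident[OF finC, of x "\<lambda>_. D" y] by (simp only: K_def)
    then show "op_diff ident (gd (h c s) i) x y = lift c (op_diff ident (rank_one (vec c i s))) x y"
      unfolding gd_def op lift_def tensor_op_op_diff[OF finC that(1)] by (simp add: op_diff_def)
  qed

  define \<Phi> where "\<Phi> = copies I (card I - 1) \<Psi>"
  define P where "P = born I (\<lambda>_. K) E (ket_bra \<Phi>)"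
  \<comment> \<open>An event of ladder \<open>c\<close> is enlarged to an event on copy
    \<open>c\<close> alone; the other copies then contribute the factor 1.\<close>
  have P_le: "P \<alpha> \<xi> \<le> Re (quad (I \<rightarrow>\<^sub>E D) (tensor_op I S) \<Psi>)"
    if "c \<in> C" "\<And>i. i \<in> I \<Longrightarrow> subprojector K (E i (\<xi> i) (\<alpha> i)) (lift c (S i))" for c \<alpha> \<xi> S
  proof -
    have "P \<alpha> \<xi> \<le> Re (quad (I \<rightarrow>\<^sub>E K) (tensor_op I (\<lambda>i. lift c (S i))) \<Phi>)"
      unfolding P_def born_ket_bra
      by (intro quad_mono subprojector_tensor_op) (use that I finK in auto)
    also have "quad (I \<rightarrow>\<^sub>E K) (tensor_op I (\<lambda>i. lift c (S i))) \<Phi> = quad (I \<rightarrow>\<^sub>E D) (tensor_op I S) \<Psi>"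
      unfolding K_def lift_def \<Phi>_def C_def
      by (rule quad_copies_single) (use I D state that C_def in auto)
    finally show ?thesis .
  qed
  define out where "out = (\<lambda>i\<in>I. 1 :: nat)"
  define inp where "inp = (\<lambda>i\<in>I. x0)"
  have h0: "h c 0 = x0" for c by (simp add: h_def x0_def)
  have "P out inp = Re (quad (I \<rightarrow>\<^sub>E K) (tensor_op I (\<lambda>i. tensor_op C (\<lambda>c. rank_one (vec c i 0)))) \<Phi>)"
    unfolding P_def born_ket_bra
    by (intro arg_cong[where f = Re] quad_cong)
      (simp add: tensor_op_def out_def inp_def E_def gd_def op_def x0_def)
  also have "\<dots> = Re (\<Prod>c\<in>C. quad (I \<rightarrow>\<^sub>E D) (tensor_op I (\<lambda>i. rank_one (vec c i 0))) \<Psi>)"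
    unfolding K_def C_def \<Phi>_def by (subst quad_copies[OF I(1) D]) (rule refl)
  also have "\<dots> = (\<Prod>c\<in>C. (cmod (multi_eval I (\<lambda>_. D) \<Psi> (\<lambda>i. vec c i 0)))\<^sup>2)"
    by (simp only: quad_rank_one of_real_prod[symmetric] Re_complex_of_real)
  also have "\<dots> = p"
    unfolding p_def
  proof (rule prod.cong[OF refl])
    fix c assume c: "c \<in> C"
    have "(\<lambda>i. vec c i 0) = (r c)(u c := a0 c, v c := b0 c)"
      using uv[OF c] ab(1,2)[OF c] by (auto simp: vec_def)
    then show "(cmod (multi_eval I (\<lambda>_. D) \<Psi> (\<lambda>i. vec c i 0)))\<^sup>2 = (cmod (amp c (r c) (a0 c) (b0 c)))\<^sup>2"
      by (simp add: amp_def)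
  qed
  finally have P_start: "P out inp = p" .

  have defect: "ladder_defect I x0 P (u c) (v c) (N c) (h c) < \<epsilon>" if c: "c \<in> C" for c
  proof -
    note uvc = uv[OF c]
    \<comment> \<open>Parties off the edge keep the bottom input; what remains of it on copy
      \<open>c\<close> is their fixed vector \<open>r c i\<close>.\<close>
    have rest: "subprojector K (gd x0 i) (lift c (rank_one (r c i)))" if "i \<in> I" "i \<noteq> u c" "i \<noteq> v c" for i
      using gd_lift[OF c that(1), of 0] that by (simp add: vec_def h0)
    have t1: "P (out(v c := 0)) (inp(u c := h c s, v c := h c (Suc s)))
        \<le> (\<Sum>y\<in>D. (cmod (amp c (r c) (a c s) (ket y)))\<^sup>2) - (cmod (amp c (r c) (a c s) (b c (Suc s))))\<^sup>2"
      if s: "s < N c" for s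
    proof -
      let ?w = "(r c)(u c := a c s)"
      let ?S = "(\<lambda>j. rank_one (?w j))(v c := op_diff ident (rank_one (b c (Suc s))))"
      have "P (out(v c := 0)) (inp(u c := h c s, v c := h c (Suc s))) \<le> Re (quad (I \<rightarrow>\<^sub>E D) (tensor_op I ?S) \<Psi>)"
      proof (rule P_le[OF c])
        fix i assume "i \<in> I"
        then show "subprojector K (E i ((inp(u c := h c s, v c := h c (Suc s))) i) ((out(v c := 0)) i)) (lift c (?S i))"
          using uvc s rest[of i] gd_lift[OF c uvc(1), of s] bad_lift[OF c uvc(2), of "Suc s"]
          by (auto simp: E_def out_def inp_def vec_def)
      qed
      also have "Re (quad (I \<rightarrow>\<^sub>E D) (tensor_op I ?S) \<Psi>)
          = (\<Sum>y\<in>D. (cmod (amp c (r c) (a c s) (ket y)))\<^sup>2) - (cmod (amp c (r c) (a c s) (b c (Suc s))))\<^sup>2"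
        by (subst quad_complement[OF I(1) uvc(2) D]) (simp only: Re_complex_of_real amp_def)
      finally show ?thesis .
    qed
    have t2: "P (out(u c := 0)) (inp(u c := h c (Suc s), v c := h c (Suc s)))
        \<le> (\<Sum>x\<in>D. (cmod (amp c (r c) (ket x) (b c (Suc s))))\<^sup>2) - (cmod (amp c (r c) (a c (Suc s)) (b c (Suc s))))\<^sup>2"
      if s: "s < N c" for s
    proof -
      let ?w = "(r c)(v c := b c (Suc s))"
      let ?S = "(\<lambda>j. rank_one (?w j))(u c := op_diff ident (rank_one (a c (Suc s))))"
      have "P (out(u c := 0)) (inp(u c := h c (Suc s), v c := h c (Suc s))) \<le> Re (quad (I \<rightarrow>\<^sub>E D) (tensor_op I ?S) \<Psi>)"
      proof (rule P_le[OF c])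
        fix i assume "i \<in> I"
        then show "subprojector K (E i ((inp(u c := h c (Suc s), v c := h c (Suc s))) i) ((out(u c := 0)) i)) (lift c (?S i))"
          using uvc s rest[of i] gd_lift[OF c uvc(2), of "Suc s"] bad_lift[OF c uvc(1), of "Suc s"]
          by (auto simp: E_def out_def inp_def vec_def)
      qed
      also have "Re (quad (I \<rightarrow>\<^sub>E D) (tensor_op I ?S) \<Psi>)
          = (\<Sum>x\<in>D. (cmod (amp c (r c) (ket x) (b c (Suc s))))\<^sup>2) - (cmod (amp c (r c) (a c (Suc s)) (b c (Suc s))))\<^sup>2"
        by (subst quad_complement[OF I(1) uvc(1) D])
          (simp only: Re_complex_of_real amp_def fun_upd_twist[OF uvc(3)[symmetric], of "r c"])
      finally show ?thesis .
    qed
    have t3: "P out (inp(u c := h c (N c))) \<le> (cmod (amp c (r c) (a c (N c)) (b c 0)))\<^sup>2"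
    proof -
      let ?w = "(r c)(u c := a c (N c), v c := b c 0)"
      have "P out (inp(u c := h c (N c))) \<le> Re (quad (I \<rightarrow>\<^sub>E D) (tensor_op I (\<lambda>j. rank_one (?w j))) \<Psi>)"
      proof (rule P_le[OF c])
        fix i assume "i \<in> I"
        then show "subprojector K (E i ((inp(u c := h c (N c))) i) (out i)) (lift c (rank_one (?w i)))"
          using uvc rest[of i] gd_lift[OF c uvc(1), of "N c"] gd_lift[OF c uvc(2), of 0]
          by (auto simp: E_def out_def inp_def vec_def h0)
      qed
      then show ?thesis by (simp only: quad_rank_one Re_complex_of_real amp_def)
    qed
    have "ladder_defect I x0 P (u c) (v c) (N c) (h c) \<le> ladder_error D D (amp c (r c)) (N c) (a c) (b c)"
      unfolding ladder_defect_def ladder_error_def Let_def out_def[symmetric] inp_def[symmetric]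
      by (intro add_mono sum_mono t1 t2 t3) auto
    then show ?thesis using ab(5)[OF c] by linarith
  qed
  have "(\<Sum>c\<in>C. ladder_defect I x0 P (u c) (v c) (N c) (h c)) \<le> card C * \<epsilon>"
    using defect by (intro sum_bounded_above) (auto intro: less_imp_le)
  also have "\<dots> < p" using p0 by (simp add: \<epsilon>_def field_simps)
  finally have small: "(\<Sum>c\<in>C. ladder_defect I x0 P (u c) (v c) (N c) (h c)) < P (\<lambda>i\<in>I. 1) (\<lambda>i\<in>I. x0)"
    using P_start by (simp only: out_def inp_def)
  have "gmnl_dist I (\<lambda>_. {0, 1}) (\<lambda>_. X) P"
    by (rule gmnl_dist_if_ladders_small[OF I(1) finC _ _ _ cross small])
      (use uv hX h0 in \<open>auto simp: X_def\<close>)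
  moreover have "finite X" "X \<noteq> {}" using finC by (auto simp: X_def)
  ultimately show ?thesis
    unfolding gmnl_state_def C_def[symmetric] K_def[symmetric] \<Phi>_def[symmetric] P_def
    using povm by (intro exI[of _ "\<lambda>_. {0, 1}"] exI[of _ "\<lambda>_. X"] exI[of _ E]) auto
qed

theorem theorem2:
  fixes n d :: nat and \<Psi> :: "(nat \<Rightarrow> nat) \<Rightarrow> complex"
  assumes "n \<ge> 2" and "d > 0"
    and "pure_state ({1..n} \<rightarrow>\<^sub>E {1..d}) \<Psi>"
    and "gme {1..n} (\<lambda>i. {1..d}) \<Psi>"
  shows "gmnl_state {1..n} (\<lambda>i. {1..n - 1} \<rightarrow>\<^sub>E {1..d}) (ket_bra (copies {1..n} (n - 1) \<Psi>))"
  using gme_copies_gmnl[of "{1..n}" "{1..d}" \<Psi>] assms by simp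

end
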